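(* For every set of variables $\Sigma$ and terms $s, t$ (with $s$ of type $\tau_1\to\cdots\to\tau_n\to\tau$ and $t$ of type $\tau$), the set $S(\Sigma,s,t)$ is a complete set of nominal abstraction solutions for $s \unrhd t$ on $\Sigma$.
   Context: Terms are simply typed $\lambda$-terms identified up to $\alpha\beta\eta$-conversion; constants are partitioned into nominal constants $\mathcal{C}$ and others; $\mathrm{supp}(t)$ is the set of nominal constants in $t$. A permutation $\pi$ is a type-preserving bijection of $\mathcal{C}$ moving finitely many elements, applied homomorphically to terms. A substitution is a type-preserving map from variables to terms that is the identity except on finitely many variables, written $\{t_1/x_1,\ldots,t_n/x_n\}$; $\mathrm{supp}(\theta)$ is the set of nominal constants in its range; $\theta\restriction\Sigma$ agrees with $\theta$ on $\Sigma$ and is the identity elsewhere; $\pi.\theta$ replaces each $t/x$ by $(\pi.t)/x$. $B[\theta]$ is ordinary substitution and $B\langle\theta\rangle=(\pi.B)[\theta]$ with $\pi$ any permutation mapping $\mathrm{supp}(B)$ outside $\mathrm{supp}(\theta)$. $\theta\circ\rho$ is the usual composition ($B[\theta\circ\rho]=B[\theta][\rho]$), and the nominal capture-avoiding composition is $\theta\bullet\rho=(\pi.\theta)\circ\rho$ for any $\pi$ with $\mathrm{supp}(\pi.\theta)\cap\mathrm{supp}(\rho)=\emptyset$. $\theta\approx\rho$ iff $\theta=\pi.\rho$ for some permutation $\pi$. $\rho\le\theta$ iff there is $\sigma$ with $\rho\approx\theta\bullet\sigma$, and $\rho\le_\Sigma\theta$ iff $\rho\restriction\Sigma\le\theta\restriction\Sigma$.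 The nominal abstraction $s\unrhd t$ of degree $n$ holds iff $s$ $\lambda$-converts to $\lambda c_1\ldots\lambda c_n.t$ (abstracting the nominal constants $c_i$ out of $t$) for some distinct nominal constants $c_i$; $\theta$ is a solution to $s\unrhd t$ iff $(s\unrhd t)\langle\theta\rangle$ (applying $\theta$ to the whole formula) holds. A complete set of nominal abstraction solutions of $s$ and $t$ on $\Sigma$ is a set $S$ of substitutions such that every $\theta\in S$ is a solution to $s\unrhd t$ and for every solution $\rho$ there is $\theta\in S$ with $\rho\le_\Sigma\theta$. For terms $u,v$, $\mathrm{CSU}(u,v)$ denotes an arbitrary fixed complete set of unifiers for the higher-order unification problem $u=v$. Definition of $S(\Sigma,s,t)$: let $c_1,\ldots,c_n$ be distinct nominal constants not in $\mathrm{supp}(s\unrhd t)$ with $c_i$ of type $\tau_i$; for each $h\in\Sigma$ of type $\tau'$ let $h'$ be a distinct new variable not in $\Sigma$ of type $\tau_1\to\cdots\to\tau_n\to\tau'$; let $\sigma=\{h'\ c_1\ \ldots\ c_n/h \mid h\in\Sigma\}$, $s'=s[\sigma]$, $t'=t[\sigma]$; let $C=\bigcup_{\vec a}\mathrm{CSU}(\lambda\vec b.s',\ \lambda\vec b.\lambda\vec a.t')$, where $\vec a=a_1,\ldots,a_n$ ranges over all selections of $n$ distinct nominal constants from $\mathrm{supp}(t)\cup\{c_1,\ldots,c_n\}$ with $a_i$ of type $\tau_i$, and $\vec b$ is a listing of all nominal constants of $s'$ and $t'$ not in $\vec a$ (here $\lambda$ over nominal constants means abstracting them out); then $S(\Sigma,s,t)=\{\sigma\bullet\rho\mid\rho\in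 C\}$.
   Formalization: Proved for finite Σ containing all free variables of s and t; ρ ≤_Σ θ compares the instance with ρ on Σ only; unifiers may not use nominal constants of the problem u=v, and each CSU is complete also on the raised variables h'. The literal statement fails without these. *)

theory Defs
  imports Main
begin

subsection \<open>Raw terms\<close>

text \<open>
  Raw terms are Church-style: bound variables are de Bruijn indices; free variables and nominal
  constants carry their type, so that there are infinitely many of each at every type.
\<close>

datatype ty = Base nat | Fun ty ty

datatype var = V nat (vty: ty)

datatype nom = N nat (nty: ty)

abbreviation Funs :: "ty list \<Rightarrow> ty \<Rightarrow> ty" where
  "Funs \<tau>s \<tau> \<equiv> foldr Fun \<tau>s \<tau>"

text \<open>
  The class fixes an arbitrary signature of non-nominal constants; names mapped to
  \<^const>\<open>None\<close> are not constants of the signature.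
\<close>

class signature =
  fixes const_ty :: "'a \<Rightarrow> ty option"

datatype 'k raw = Bnd nat | Free var | Nom nom | Cst 'k | App "'k raw" "'k raw" | Lam ty "'k raw"

fun tyof :: "ty list \<Rightarrow> 'k::signature raw \<Rightarrow> ty option" where
  "tyof \<Gamma> (Bnd i) = (if i < length \<Gamma> then Some (\<Gamma> ! i) else None)"
| "tyof \<Gamma> (Free x) = Some (vty x)"
| "tyof \<Gamma> (Nom c) = Some (nty c)"
| "tyof \<Gamma> (Cst k) = const_ty k"
| "tyof \<Gamma> (App r u) =
    (case tyof \<Gamma> r of
       Some (Fun A B) \<Rightarrow> if tyof \<Gamma> u = Some A then Some B else None
     | _ \<Rightarrow> None)"
| "tyof \<Gamma> (Lam A r) = map_option (Fun A) (tyof (A # \<Gamma>) r)"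

primrec lift :: "nat \<Rightarrow> 'k raw \<Rightarrow> 'k raw" where
  "lift k (Bnd i) = (if i < k then Bnd i else Bnd (Suc i))"
| "lift k (Free x) = Free x"
| "lift k (Nom c) = Nom c"
| "lift k (Cst a) = Cst a"
| "lift k (App r u) = App (lift k r) (lift k u)"
| "lift k (Lam A r) = Lam A (lift (Suc k) r)"

primrec inst :: "nat \<Rightarrow> 'k raw \<Rightarrow> 'k raw \<Rightarrow> 'k raw" where
  "inst k w (Bnd i) = (if i < k then Bnd i else if i = k then w else Bnd (i - 1))"
| "inst k w (Free x) = Free x"
| "inst k w (Nom c) = Nom c"
| "inst k w (Cst a) = Cst a"
| "inst k w (App r u) = App (inst k w r) (inst k w u)"
| "inst k w (Lam A r) = Lam A (inst (Suc k) (lift 0 w) r)"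

inductive conv :: "ty list \<Rightarrow> ty \<Rightarrow> 'k::signature raw \<Rightarrow> 'k raw \<Rightarrow> bool" where
  conv_refl: "tyof \<Gamma> r = Some A \<Longrightarrow> conv \<Gamma> A r r"
| conv_sym: "conv \<Gamma> A r r' \<Longrightarrow> conv \<Gamma> A r' r"
| conv_trans: "conv \<Gamma> A r r' \<Longrightarrow> conv \<Gamma> A r' r'' \<Longrightarrow> conv \<Gamma> A r r''"
| conv_App: "conv \<Gamma> (Fun A B) r r' \<Longrightarrow> conv \<Gamma> A u u' \<Longrightarrow> conv \<Gamma> B (App r u) (App r' u')"
| conv_Lam: "conv (A # \<Gamma>) B r r' \<Longrightarrow> conv \<Gamma> (Fun A B) (Lam A r) (Lam A r')"
| conv_beta: "tyof (A # \<Gamma>) r = Some B \<Longrightarrow> tyof \<Gamma> u = Some A \<Longrightarrow>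
    conv \<Gamma> B (App (Lam A r) u) (inst 0 u r)"
| conv_eta: "tyof \<Gamma> r = Some (Fun A B) \<Longrightarrow>
    conv \<Gamma> (Fun A B) (Lam A (App (lift 0 r) (Bnd 0))) r"

lemma tyof_lift:
  "tyof (\<Gamma> @ \<Delta>) r = Some B \<Longrightarrow> tyof (\<Gamma> @ A # \<Delta>) (lift (length \<Gamma>) r) = Some B"
proof (induction r arbitrary: \<Gamma> B)
  case (Bnd i)
  then show ?case by (auto simp: nth_append Suc_diff_le split: if_splits)
next
  case (App r u)
  then show ?case by (fastforce split: option.splits ty.splits if_splits)
next
  case (Lam C r)
  from Lam.prems obtain D where D: "tyof ((C # \<Gamma>) @ \<Delta>) r = Some D" "B = Fun C D" by auto
  from Lam.IH[OF D(1)] D(2) show ?case by simp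
qed auto

lemma tyof_inst:
  "tyof (\<Gamma> @ A # \<Delta>) r = Some B \<Longrightarrow> tyof (\<Gamma> @ \<Delta>) w = Some A \<Longrightarrow>
   tyof (\<Gamma> @ \<Delta>) (inst (length \<Gamma>) w r) = Some B"
proof (induction r arbitrary: \<Gamma> B w)
  case (Bnd i)
  show ?case
  proof (cases "i \<le> length \<Gamma>")
    case True
    with Bnd show ?thesis by (auto simp: nth_append split: if_splits)
  next
    case False
    then obtain j where "i = Suc (length \<Gamma> + j)" by (metis less_imp_Suc_add not_le)
    with Bnd show ?thesis by (auto simp: nth_append split: if_splits)
  qed
next
  case (App r u)
  then show ?case by (fastforce split: option.splits ty.splits if_splits)
next
  case (Lam C r)
  from Lam.prems obtain D where D: "tyof ((C # \<Gamma>) @ A # \<Delta>) r = Some D" "B = Fun C D" by auto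
  have "tyof ((C # \<Gamma>) @ \<Delta>) (lift 0 w) = Some A"
    using tyof_lift[of "[]" "\<Gamma> @ \<Delta>" w A C] Lam.prems(2) by simp
  from Lam.IH[OF D(1) this] D(2) show ?case by simp
qed auto

lemma conv_tyof: "conv \<Gamma> A r r' \<Longrightarrow> tyof \<Gamma> r = Some A \<and> tyof \<Gamma> r' = Some A"
proof (induction rule: conv.induct)
  case (conv_beta A \<Gamma> r B u)
  then show ?case using tyof_inst[of "[]" A \<Gamma> r B u] by simp
next
  case (conv_eta \<Gamma> r A B)
  then show ?case using tyof_lift[of "[]" \<Gamma> r "Fun A B" A] by simp
qed auto

definition eqv :: "'k::signature raw \<Rightarrow> 'k raw \<Rightarrow> bool" where
  "eqv r r' \<longleftrightarrow> (\<exists>A. conv [] A r r')"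

primrec noms :: "'k raw \<Rightarrow> nom set" where
  "noms (Bnd i) = {}"
| "noms (Free x) = {}"
| "noms (Nom c) = {c}"
| "noms (Cst k) = {}"
| "noms (App r u) = noms r \<union> noms u"
| "noms (Lam A r) = noms r"

primrec frees :: "'k raw \<Rightarrow> var set" where
  "frees (Bnd i) = {}"
| "frees (Free x) = {x}"
| "frees (Nom c) = {}"
| "frees (Cst k) = {}"
| "frees (App r u) = frees r \<union> frees u"
| "frees (Lam A r) = frees r"

primrec raw_perm :: "(nom \<Rightarrow> nom) \<Rightarrow> 'k raw \<Rightarrow> 'k raw" where
  "raw_perm \<pi> (Bnd i) = Bnd i"
| "raw_perm \<pi> (Free x) = Free x"
| "raw_perm \<pi> (Nom c) = Nom (\<pi> c)"
| "raw_perm \<pi> (Cst k) = Cst k"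
| "raw_perm \<pi> (App r u) = App (raw_perm \<pi> r) (raw_perm \<pi> u)"
| "raw_perm \<pi> (Lam A r) = Lam A (raw_perm \<pi> r)"

text \<open>No lifting under \<^const>\<open>Lam\<close>: only used for \<open>\<theta>\<close> whose values have no dangling indices.\<close>

primrec raw_subst :: "(var \<Rightarrow> 'k raw) \<Rightarrow> 'k raw \<Rightarrow> 'k raw" where
  "raw_subst \<theta> (Bnd i) = Bnd i"
| "raw_subst \<theta> (Free x) = \<theta> x"
| "raw_subst \<theta> (Nom c) = Nom c"
| "raw_subst \<theta> (Cst k) = Cst k"
| "raw_subst \<theta> (App r u) = App (raw_subst \<theta> r) (raw_subst \<theta> u)"
| "raw_subst \<theta> (Lam A r) = Lam A (raw_subst \<theta> r)"

primrec raw_close :: "nat \<Rightarrow> nom \<Rightarrow> 'k raw \<Rightarrow> 'k raw" where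
  "raw_close k c (Bnd i) = (if i < k then Bnd i else Bnd (Suc i))"
| "raw_close k c (Free x) = Free x"
| "raw_close k c (Nom d) = (if d = c then Bnd k else Nom d)"
| "raw_close k c (Cst a) = Cst a"
| "raw_close k c (App r u) = App (raw_close k c r) (raw_close k c u)"
| "raw_close k c (Lam A r) = Lam A (raw_close (Suc k) c r)"


subsection \<open>Terms\<close>

text \<open>Closed (no dangling index) well-typed raw terms modulo conversion.\<close>

quotient_type (overloaded) 'k tm = "'k::signature raw" / partial: eqv
proof (rule part_equivpI)
  show "\<exists>r::'k raw. eqv r r"
    unfolding eqv_def by (metis conv_refl tyof.simps(2))
  show "symp (eqv :: 'k raw \<Rightarrow> _)"
    unfolding eqv_def by (auto intro!: sympI dest: conv_sym)
  show "transp (eqv :: 'k raw \<Rightarrow> _)"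
  proof (rule transpI)
    fix r r' r'' :: "'k raw"
    assume "eqv r r'" "eqv r' r''"
    then obtain A B where AB: "conv [] A r r'" "conv [] B r' r''" unfolding eqv_def by blast
    from AB have "A = B" using conv_tyof by (metis option.inject)
    with AB show "eqv r r''" unfolding eqv_def by (blast intro: conv_trans)
  qed
qed

definition tm_ty :: "'k::signature tm \<Rightarrow> ty" where
  "tm_ty t = the (tyof [] (rep_tm t))"

definition tm_var :: "var \<Rightarrow> 'k::signature tm" where
  "tm_var x = abs_tm (Free x)"

definition tm_perm :: "(nom \<Rightarrow> nom) \<Rightarrow> 'k::signature tm \<Rightarrow> 'k tm" where
  "tm_perm \<pi> t = abs_tm (raw_perm \<pi> (rep_tm t))"

definition lam_nom :: "nom \<Rightarrow> 'k::signature tm \<Rightarrow> 'k tm" where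
  "lam_nom c t = abs_tm (Lam (nty c) (raw_close 0 c (rep_tm t)))"

abbreviation lam_noms :: "nom list \<Rightarrow> 'k::signature tm \<Rightarrow> 'k tm" where
  "lam_noms cs t \<equiv> foldr lam_nom cs t"

text \<open>
  Convertible raw terms may differ in vacuous occurrences (contracting a redex can erase its
  argument), so a symbol occurs in a term if it occurs in every representative. As reduction never
  creates occurrences, these are the symbols of the normal form.
\<close>

definition supp :: "'k::signature tm \<Rightarrow> nom set" where
  "supp t = (\<Inter>r \<in> {r. eqv (rep_tm t) r}. noms r)"

definition fv :: "'k::signature tm \<Rightarrow> var set" where
  "fv t = (\<Inter>r \<in> {r. eqv (rep_tm t) r}. frees r)"

definition is_perm :: "(nom \<Rightarrow> nom) \<Rightarrow> bool" where
  "is_perm \<pi> \<longleftrightarrow> bij \<pi> \<and> (\<forall>c. nty (\<pi> c) = nty c) \<and> finite {c. \<pi> c \<noteq> c}"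


subsection \<open>Substitutions\<close>

type_synonym 'k subst = "var \<Rightarrow> 'k tm"

definition is_subst :: "'k::signature subst \<Rightarrow> bool" where
  "is_subst \<theta> \<longleftrightarrow> (\<forall>x. tm_ty (\<theta> x) = vty x) \<and> finite {x. \<theta> x \<noteq> tm_var x}"

definition tm_subst :: "'k::signature tm \<Rightarrow> 'k subst \<Rightarrow> 'k tm" where
  "tm_subst t \<theta> = abs_tm (raw_subst (\<lambda>x. rep_tm (\<theta> x)) (rep_tm t))"

definition supp_subst :: "'k::signature subst \<Rightarrow> nom set" where
  "supp_subst \<theta> = (\<Union>x. supp (\<theta> x))"

definition restr :: "var set \<Rightarrow> 'k::signature subst \<Rightarrow> 'k subst" where
  "restr \<Sigma> \<theta> = (\<lambda>x. if x \<in> \<Sigma> then \<theta> x else tm_var x)"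

definition perm_subst :: "(nom \<Rightarrow> nom) \<Rightarrow> 'k::signature subst \<Rightarrow> 'k subst" where
  "perm_subst \<pi> \<theta> = (\<lambda>x. tm_perm \<pi> (\<theta> x))"

definition comp_subst :: "'k::signature subst \<Rightarrow> 'k subst \<Rightarrow> 'k subst" where
  "comp_subst \<theta> \<rho> = (\<lambda>x. tm_subst (\<theta> x) \<rho>)"

definition nom_comp :: "'k::signature subst \<Rightarrow> 'k subst \<Rightarrow> 'k subst" where
  "nom_comp \<theta> \<rho> =
    (let \<pi> = SOME \<pi>. is_perm \<pi> \<and> supp_subst (perm_subst \<pi> \<theta>) \<inter> supp_subst \<rho> = {}
     in comp_subst (perm_subst \<pi> \<theta>) \<rho>)"

definition subst_equiv :: "'k::signature subst \<Rightarrow> 'k subst \<Rightarrow> bool" where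
  "subst_equiv \<theta> \<rho> \<longleftrightarrow> (\<exists>\<pi>. is_perm \<pi> \<and> \<theta> = perm_subst \<pi> \<rho>)"

text \<open>
  The instance \<open>\<theta>\<restriction>\<Sigma> \<bullet> \<sigma>\<close> is compared with \<open>\<rho>\<restriction>\<Sigma>\<close> on \<open>\<Sigma>\<close> only: off \<open>\<Sigma>\<close> it coincides with
  \<open>\<sigma>\<close>, which must be free to instantiate the variables that \<open>\<theta>\<close> introduces.
\<close>

definition less_general_on :: "var set \<Rightarrow> 'k::signature subst \<Rightarrow> 'k subst \<Rightarrow> bool" where
  "less_general_on \<Sigma> \<rho> \<theta> \<longleftrightarrow>
    (\<exists>\<sigma>. is_subst \<sigma> \<and> subst_equiv (restr \<Sigma> \<rho>) (restr \<Sigma> (nom_comp (restr \<Sigma> \<theta>) \<sigma>)))"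


subsection \<open>Nominal abstraction\<close>

context
  notes [[typedef_overloaded]]
begin

datatype 'k formula = NAbs nat "'k::signature tm" "'k tm"

end

primrec supp_form :: "'k::signature formula \<Rightarrow> nom set" where
  "supp_form (NAbs n s t) = supp s \<union> supp t"

primrec perm_form :: "(nom \<Rightarrow> nom) \<Rightarrow> 'k::signature formula \<Rightarrow> 'k formula" where
  "perm_form \<pi> (NAbs n s t) = NAbs n (tm_perm \<pi> s) (tm_perm \<pi> t)"

primrec subst_form :: "'k::signature formula \<Rightarrow> 'k subst \<Rightarrow> 'k formula" where
  "subst_form (NAbs n s t) \<theta> = NAbs n (tm_subst s \<theta>) (tm_subst t \<theta>)"

definition nom_subst_form :: "'k::signature formula \<Rightarrow> 'k subst \<Rightarrow> 'k formula" where
  "nom_subst_form B \<theta> =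
    (let \<pi> = SOME \<pi>. is_perm \<pi> \<and> \<pi> ` supp_form B \<inter> supp_subst \<theta> = {}
     in subst_form (perm_form \<pi> B) \<theta>)"

primrec holds :: "'k::signature formula \<Rightarrow> bool" where
  "holds (NAbs n s t) \<longleftrightarrow> (\<exists>cs. length cs = n \<and> distinct cs \<and> s = lam_noms cs t)"

definition na_solution :: "'k::signature formula \<Rightarrow> 'k subst \<Rightarrow> bool" where
  "na_solution B \<theta> \<longleftrightarrow> is_subst \<theta> \<and> holds (nom_subst_form B \<theta>)"

definition complete_na_solutions ::
  "var set \<Rightarrow> 'k::signature formula \<Rightarrow> 'k subst set \<Rightarrow> bool" where
  "complete_na_solutions \<Sigma> B S \<longleftrightarrow>
    (\<forall>\<theta> \<in> S. na_solution B \<theta>) \<and>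
    (\<forall>\<rho>. na_solution B \<rho> \<longrightarrow> (\<exists>\<theta> \<in> S. less_general_on \<Sigma> \<rho> \<theta>))"


subsection \<open>Complete sets of unifiers\<close>

text \<open>
  The nominal constants occurring in a unification problem are scoped inside its unknowns, so a
  unifier may not mention them. For problems without nominal constants this is the usual notion.
\<close>

definition unifier :: "'k::signature tm \<Rightarrow> 'k tm \<Rightarrow> 'k subst \<Rightarrow> bool" where
  "unifier u v \<theta> \<longleftrightarrow>
    is_subst \<theta> \<and> tm_subst u \<theta> = tm_subst v \<theta> \<and> supp_subst \<theta> \<inter> (supp u \<union> supp v) = {}"

text \<open>
  Completeness is relative to a set \<open>W\<close> of protected variables: the auxiliary variables introduced
  by a unifier must not interfere with those in \<open>W\<close>, even if they are not free in the problem.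
\<close>

definition complete_unifiers ::
  "var set \<Rightarrow> 'k::signature tm \<Rightarrow> 'k tm \<Rightarrow> 'k subst set \<Rightarrow> bool" where
  "complete_unifiers W u v U \<longleftrightarrow>
    (\<forall>\<theta> \<in> U. unifier u v \<theta>) \<and>
    (\<forall>\<rho>. unifier u v \<rho> \<longrightarrow>
      (\<exists>\<theta> \<in> U. \<exists>\<gamma>. is_subst \<gamma> \<and> (\<forall>x \<in> W \<union> fv u \<union> fv v. \<rho> x = comp_subst \<theta> \<gamma> x)))"


subsection \<open>The set of solutions obtained by raising and unification\<close>

text \<open>
  The arbitrary choices made in the construction are parameters: the fresh nominal constants
  \<open>cs\<close>, the raised variables \<open>h' = prime h\<close>, the listing \<open>bs as\<close> of the remaining nominal constants
  for a selection \<open>as\<close>, and the complete sets of unifiers \<open>CSU\<close>.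
\<close>

definition raising :: "var set \<Rightarrow> (var \<Rightarrow> var) \<Rightarrow> nom list \<Rightarrow> 'k::signature subst" where
  "raising \<Sigma> prime cs =
    (\<lambda>h. if h \<in> \<Sigma> then abs_tm (foldl App (Free (prime h)) (map Nom cs)) else tm_var h)"

definition selections :: "'k::signature tm \<Rightarrow> nom list \<Rightarrow> nom list set" where
  "selections t cs =
    {as. distinct as \<and> set as \<subseteq> supp t \<union> set cs \<and> map nty as = map nty cs}"

definition solution_set ::
  "(var \<Rightarrow> var) \<Rightarrow> nom list \<Rightarrow> (nom list \<Rightarrow> nom list) \<Rightarrow>
   ('k tm \<Rightarrow> 'k tm \<Rightarrow> 'k subst set) \<Rightarrow>
   var set \<Rightarrow> 'k::signature tm \<Rightarrow> 'k tm \<Rightarrow> 'k subst set" where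
  "solution_set prime cs bs CSU \<Sigma> s t =
    (let \<sigma> = raising \<Sigma> prime cs;
         s' = tm_subst s \<sigma>;
         t' = tm_subst t \<sigma>;
         C = (\<Union>as \<in> selections t cs.
                CSU (lam_noms (bs as) s') (lam_noms (bs as) (lam_noms as t')))
     in {nom_comp \<sigma> \<rho> | \<rho>. \<rho> \<in> C})"

end

theory Submission
  imports Defs
begin

text \<open>
  Soundness: a permutation that fixes the constants left free in the unification problem and moves
  all others away from the unifier \<open>\<rho>\<close> lets \<open>\<rho>\<close> commute with the abstractions; stripping \<open>\<lambda>\<close> over
  \<open>bs\<close> leaves the nominal abstraction itself.

  Completeness: after a renaming, a solution \<open>\<rho>\<close> satisfies \<open>s[\<rho>] = \<lambda>as. t[\<rho>]\<close> for a selection \<open>as\<close>,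
  and \<open>h' \<mapsto> \<lambda>cs. \<rho> h\<close> is a unifier. A member \<open>\<theta>\<close> of the complete set that covers it by \<open>\<theta> \<circ> \<gamma>\<close> may
  share nominal constants with \<open>\<gamma>\<close>, whereas \<open>\<bullet>\<close> keeps them apart. So the constants of the unifier are
  first replaced by fresh variables: if \<open>\<theta> \<circ> \<gamma>\<close> mentions no constants at all, renaming those of \<open>\<gamma>\<close> alone
  does not change it. This is a property of \<open>\<beta>\<eta>\<close>-conversion (identifying constants cannot erase
  them); it follows from the completeness of Crary-style type-directed algorithmic equality, proved by
  a logical relation over closed terms in which nominal constants serve as generic arguments.
\<close>


text \<open>All but one point is bookkeeping with substitutions. The exception: renaming the
  constants of \<gamma> alone must not change a constant-free instance \<theta> \<circ> \<gamma>. A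
  law such as f x x = a would refute this: with \<theta> y = f c w and \<gamma> w = c the instance
  of y is a, but after the renaming it is f c d. Congruence and closure under substitution hold in
  the presence of such laws too, so the proof has to look at how conversion computes. Algorithmic
  equality provides this without confluence or normalisation: heads are compared after deterministic
  weak head reduction, and \<eta> is absorbed by applying both sides of function type to constants.
  As every type has infinitely many nominal constants, closed terms suffice and the logical relation
  needs no Kripke worlds.\<close>

lemma tyof_App:
  "tyof \<Gamma> (App r u) = Some B \<longleftrightarrow> (\<exists>A. tyof \<Gamma> r = Some (Fun A B) \<and> tyof \<Gamma> u = Some A)"
  by (auto split: option.splits ty.splits)

declare tyof.simps(5) [simp del] tyof_App [simp]

lemma tyof_append: "tyof \<Gamma> r = Some A \<Longrightarrow> tyof (\<Gamma> @ \<Delta>) r = Some A"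
proof (induction r arbitrary: \<Gamma> A)
  case (Bnd i)
  then show ?case by (auto simp: nth_append split: if_splits)
next
  case (App r u)
  then show ?case by fastforce
next
  case (Lam C r)
  then show ?case using Lam.IH[of "C # \<Gamma>"] by fastforce
qed auto

lemma tyof_closed: "tyof [] r = Some A \<Longrightarrow> tyof \<Gamma> r = Some A"
  using tyof_append[of "[]"] by simp

lemma conv_append: "conv \<Gamma> A r r' \<Longrightarrow> conv (\<Gamma> @ \<Delta>) A r r'"
proof (induction rule: conv.induct)
  case (conv_refl \<Gamma> r A)
  then show ?case by (simp add: conv.conv_refl tyof_append)
next
  case (conv_sym \<Gamma> A r r')
  show ?case by (rule conv.conv_sym) (rule conv_sym.IH)
next
  case (conv_trans \<Gamma> A r r' r'')
  then show ?case by (metis conv.conv_trans)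
next
  case (conv_App \<Gamma> A B r r' u u')
  then show ?case by (blast intro: conv.conv_App)
next
  case (conv_Lam A \<Gamma> B r r')
  then show ?case by (simp add: conv.conv_Lam)
next
  case (conv_beta A \<Gamma> r B u)
  then show ?case
    using tyof_append[of "A # \<Gamma>" r B \<Delta>] by (simp add: conv.conv_beta tyof_append)
next
  case (conv_eta \<Gamma> r A B)
  then show ?case by (simp add: conv.conv_eta tyof_append)
qed

lemma conv_closed: "conv [] A r r' \<Longrightarrow> conv \<Gamma> A r r'"
  using conv_append[of "[]"] by simp

lemma lift_above: "tyof \<Gamma> r = Some A \<Longrightarrow> length \<Gamma> \<le> k \<Longrightarrow> lift k r = r"
proof (induction r arbitrary: \<Gamma> A k)
  case (App r u)
  from App.prems(1) obtain B where "tyof \<Gamma> r = Some (Fun B A)" "tyof \<Gamma> u = Some B"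
    by auto
  from App.IH(1)[OF this(1) App.prems(2)] App.IH(2)[OF this(2) App.prems(2)] show ?case by simp
next
  case (Lam C r)
  from Lam.prems(1) obtain B where "tyof (C # \<Gamma>) r = Some B" by auto
  from Lam.IH[OF this, of "Suc k"] Lam.prems(2) show ?case by simp
qed (auto split: if_splits)

lemma inst_above: "tyof \<Gamma> r = Some A \<Longrightarrow> length \<Gamma> \<le> k \<Longrightarrow> inst k w r = r"
proof (induction r arbitrary: \<Gamma> A k w)
  case (App r u)
  from App.prems(1) obtain B where "tyof \<Gamma> r = Some (Fun B A)" "tyof \<Gamma> u = Some B"
    by auto
  from App.IH(1)[OF this(1) App.prems(2)] App.IH(2)[OF this(2) App.prems(2)] show ?case by simp
next
  case (Lam C r)
  from Lam.prems(1) obtain B where "tyof (C # \<Gamma>) r = Some B" by auto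
  from Lam.IH[OF this, of "Suc k"] Lam.prems(2) show ?case by simp
qed (auto split: if_splits)

lemma finite_noms [simp]: "finite (noms r)"
  by (induction r) auto

lemma finite_frees [simp]: "finite (frees r)"
  by (induction r) auto

lemma noms_lift [simp]: "noms (lift k r) = noms r"
  by (induction r arbitrary: k) auto

lemma noms_inst: "noms (inst k w r) \<subseteq> noms r \<union> noms w"
proof (induction r arbitrary: k w)
  case (App r u)
  show ?case using App.IH(1)[of k w] App.IH(2)[of k w] by auto
next
  case (Lam A r)
  then show ?case using Lam.IH[of "Suc k" "lift 0 w"] by simp
qed auto


subsection \<open>Simultaneous replacement of nominal constants and variables\<close>

text \<open>Permutations, substitutions, non-injective renamings and the exchange of constants for
  variables are all instances, so typing, conversion and composition are treated once. Values are
  put under binders unlifted, which is right for the closed values that \<open>raw_typed\<close>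
  demands.\<close>

primrec raw_map :: "(nom \<Rightarrow> 'k raw) \<Rightarrow> (var \<Rightarrow> 'k raw) \<Rightarrow> 'k raw \<Rightarrow> 'k raw" where
  "raw_map f \<theta> (Bnd i) = Bnd i"
| "raw_map f \<theta> (Free x) = \<theta> x"
| "raw_map f \<theta> (Nom c) = f c"
| "raw_map f \<theta> (Cst k) = Cst k"
| "raw_map f \<theta> (App r u) = App (raw_map f \<theta> r) (raw_map f \<theta> u)"
| "raw_map f \<theta> (Lam A r) = Lam A (raw_map f \<theta> r)"

definition raw_typed :: "(nom \<Rightarrow> 'k::signature raw) \<Rightarrow> (var \<Rightarrow> 'k raw) \<Rightarrow> bool" where
  "raw_typed f \<theta> \<longleftrightarrow>
    (\<forall>c. tyof [] (f c) = Some (nty c)) \<and> (\<forall>x. tyof [] (\<theta> x) = Some (vty x))"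

lemma raw_typed_closed:
  assumes "raw_typed f \<theta>"
  shows "tyof \<Gamma> (f c) = Some (nty c)" "tyof \<Gamma> (\<theta> x) = Some (vty x)"
    and "lift k (f c) = f c" "lift k (\<theta> x) = \<theta> x"
    and "inst k w (f c) = f c" "inst k w (\<theta> x) = \<theta> x"
proof -
  have "tyof [] (f c) = Some (nty c)" "tyof [] (\<theta> x) = Some (vty x)"
    using assms by (simp_all add: raw_typed_def)
  note t = this
  show "tyof \<Gamma> (f c) = Some (nty c)" "tyof \<Gamma> (\<theta> x) = Some (vty x)"
    by (rule tyof_closed, rule t)+
  show "lift k (f c) = f c" "lift k (\<theta> x) = \<theta> x"
    using lift_above[OF t(1)] lift_above[OF t(2)] by simp_all
  show "inst k w (f c) = f c" "inst k w (\<theta> x) = \<theta> x"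
    using inst_above[OF t(1)] inst_above[OF t(2)] by simp_all
qed

lemma raw_perm_map: "raw_perm \<pi> r = raw_map (\<lambda>c. Nom (\<pi> c)) Free r"
  by (induction r) auto

lemma raw_subst_map: "raw_subst \<theta> r = raw_map Nom \<theta> r"
  by (induction r) auto

lemma raw_map_ident [simp]: "raw_map Nom Free r = r"
  by (induction r) auto

lemma raw_map_raw_map:
  "raw_map f \<theta> (raw_map g \<eta> r) = raw_map (\<lambda>c. raw_map f \<theta> (g c)) (\<lambda>x. raw_map f \<theta> (\<eta> x)) r"
  by (induction r) auto

lemma raw_map_cong:
  "(\<And>c. c \<in> noms r \<Longrightarrow> f c = f' c) \<Longrightarrow> (\<And>x. x \<in> frees r \<Longrightarrow> \<theta> x = \<theta>' x) \<Longrightarrow>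
   raw_map f \<theta> r = raw_map f' \<theta>' r"
  by (induction r) auto

lemma noms_raw_map: "noms (raw_map f \<theta> r) = (\<Union>c\<in>noms r. noms (f c)) \<union> (\<Union>x\<in>frees r. noms (\<theta> x))"
  by (induction r) auto

lemma frees_raw_map: "frees (raw_map f \<theta> r) = (\<Union>c\<in>noms r. frees (f c)) \<union> (\<Union>x\<in>frees r. frees (\<theta> x))"
  by (induction r) auto

lemma tyof_raw_map:
  assumes "raw_typed f \<theta>"
  shows "tyof \<Gamma> r = Some A \<Longrightarrow> tyof \<Gamma> (raw_map f \<theta> r) = Some A"
proof (induction r arbitrary: \<Gamma> A)
  case (App r u)
  then show ?case by fastforce
qed (auto simp: raw_typed_closed[OF assms])

lemma raw_map_lift:
  assumes "raw_typed f \<theta>"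
  shows "raw_map f \<theta> (lift k r) = lift k (raw_map f \<theta> r)"
  by (induction r arbitrary: k) (auto simp: raw_typed_closed[OF assms])

lemma raw_map_inst:
  assumes "raw_typed f \<theta>"
  shows "raw_map f \<theta> (inst k w r) = inst k (raw_map f \<theta> w) (raw_map f \<theta> r)"
  by (induction r arbitrary: k w) (auto simp: raw_typed_closed[OF assms] raw_map_lift[OF assms])

lemma conv_raw_map:
  assumes "raw_typed f \<theta>"
  shows "conv \<Gamma> A r r' \<Longrightarrow> conv \<Gamma> A (raw_map f \<theta> r) (raw_map f \<theta> r')"
proof (induction rule: conv.induct)
  case (conv_beta A \<Gamma> r B u)
  then show ?case
    by (simp add: raw_map_inst[OF assms] conv.conv_beta tyof_raw_map[OF assms])
next
  case (conv_eta \<Gamma> r A B)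
  then show ?case
    by (simp add: raw_map_lift[OF assms] conv.conv_eta tyof_raw_map[OF assms])
next
  case (conv_sym \<Gamma> A r r')
  show ?case by (rule conv.conv_sym) (rule conv_sym.IH)
next
  case (conv_trans \<Gamma> A r r' r'')
  then show ?case by (metis conv.conv_trans)
qed (auto intro: conv_refl conv_App conv_Lam tyof_raw_map[OF assms])

text \<open>Counterpart of \<open>conv_raw_map\<close>: here the inserted terms vary up to
  conversion, there the term acted upon. Together they make the operation well defined on the
  quotient.\<close>

lemma raw_map_conv:
  assumes "tyof \<Gamma> r = Some A"
    and "\<And>c. conv [] (nty c) (f c) (f' c)" and "\<And>x. conv [] (vty x) (\<theta> x) (\<theta>' x)"
  shows "conv \<Gamma> A (raw_map f \<theta> r) (raw_map f' \<theta>' r)"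
  using assms(1)
proof (induction r arbitrary: \<Gamma> A)
  case (App r u)
  from App.prems obtain B where "tyof \<Gamma> r = Some (Fun B A)" "tyof \<Gamma> u = Some B" by auto
  from conv_App[OF App.IH(1)[OF this(1)] App.IH(2)[OF this(2)]] show ?case by simp
next
  case (Lam C r)
  then show ?case by (auto intro: conv_Lam)
next
  case (Free x)
  then show ?case using conv_closed[OF assms(3)[of x]] by auto
next
  case (Nom c)
  then show ?case using conv_closed[OF assms(2)[of c]] by auto
qed (auto intro: conv_refl)


subsection \<open>Abstracting a nominal constant\<close>

lemma noms_raw_close [simp]: "noms (raw_close k c r) = noms r - {c}"
  by (induction r arbitrary: k) auto

lemma tyof_raw_close:
  "tyof (\<Gamma> @ \<Delta>) r = Some B \<Longrightarrow> tyof (\<Gamma> @ nty c # \<Delta>) (raw_close (length \<Gamma>) c r) = Some B"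
proof (induction r arbitrary: \<Gamma> B)
  case (Bnd i)
  then show ?case by (auto simp: nth_append Suc_diff_le split: if_splits)
next
  case (App r u)
  then show ?case by fastforce
next
  case (Lam C r)
  then show ?case using Lam.IH[of "C # \<Gamma>"] by fastforce
qed auto

lemma raw_close_lift: "j \<le> k \<Longrightarrow> raw_close (Suc k) c (lift j r) = lift j (raw_close k c r)"
  by (induction r arbitrary: j k) auto

lemma raw_close_inst:
  "j \<le> k \<Longrightarrow> raw_close k c (inst j w r) = inst j (raw_close k c w) (raw_close (Suc k) c r)"
  by (induction r arbitrary: j k w) (auto simp: raw_close_lift)

lemma raw_close_fresh: "c \<notin> noms r \<Longrightarrow> raw_close k c r = lift k r"
  by (induction r arbitrary: k) auto

lemma inst_raw_close:
  "tyof \<Gamma> r = Some A \<Longrightarrow> length \<Gamma> \<le> k \<Longrightarrow> inst k (Nom c) (raw_close k c r) = r"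
proof (induction r arbitrary: \<Gamma> A k)
  case (App r u)
  from App.prems(1) obtain B where "tyof \<Gamma> r = Some (Fun B A)" "tyof \<Gamma> u = Some B"
    by auto
  from App.IH(1)[OF this(1) App.prems(2)] App.IH(2)[OF this(2) App.prems(2)] show ?case by simp
next
  case (Lam C r)
  from Lam.prems(1) obtain B where "tyof (C # \<Gamma>) r = Some B" by auto
  from Lam.IH[OF this, of "Suc k"] Lam.prems(2) show ?case by simp
qed (auto split: if_splits)

text \<open>Conversion treats a constant like a variable, so a whole derivation can be closed over
  it. Splitting the context by an equation lets the binders crossed on the way accumulate in
  \<Gamma>, in front of the new entry.\<close>

lemma conv_raw_close:
  "conv \<Gamma>' A r r' \<Longrightarrow> \<Gamma>' = \<Gamma> @ \<Delta> \<Longrightarrow>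
   conv (\<Gamma> @ nty c # \<Delta>) A (raw_close (length \<Gamma>) c r) (raw_close (length \<Gamma>) c r')"
proof (induction arbitrary: \<Gamma> rule: conv.induct)
  case (conv_Lam A \<Gamma>' B r r')
  then show ?case using conv_Lam.IH[of "A # \<Gamma>"] by (simp add: conv.conv_Lam)
next
  case (conv_beta A \<Gamma>' r B u)
  then show ?case
    using tyof_raw_close[of "A # \<Gamma>" \<Delta> r B c] tyof_raw_close[of \<Gamma> \<Delta> u A c]
    by (simp add: raw_close_inst conv.conv_beta)
next
  case (conv_eta \<Gamma>' r A B)
  then show ?case by (simp add: raw_close_lift conv.conv_eta tyof_raw_close)
next
  case (conv_sym \<Gamma>' A r r')
  show ?case by (rule conv.conv_sym) (rule conv_sym.IH[OF conv_sym.prems])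
next
  case (conv_trans \<Gamma>' A r r' r'')
  then show ?case by (metis conv.conv_trans)
next
  case (conv_App \<Gamma>' A B r r' u u')
  then show ?case by (simp add: conv.conv_App)
qed (auto intro: conv_refl tyof_raw_close)

text \<open>A fresh constant is a generic argument: closing over \<open>c\<close> acts on
  \<open>s\<close> and \<open>t\<close> as lifting, so the two applications become the bodies of
  \<eta>-redexes that contract to \<open>s\<close> and \<open>t\<close>.\<close>

lemma conv_ext:
  assumes "conv [] B (App s (Nom c)) (App t (Nom c))" and "c \<notin> noms s" "c \<notin> noms t"
    and "tyof [] s = Some (Fun (nty c) B)" "tyof [] t = Some (Fun (nty c) B)"
  shows "conv [] (Fun (nty c) B) s t"
proof -
  have "conv [nty c] B (App (lift 0 s) (Bnd 0)) (App (lift 0 t) (Bnd 0))"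
    using conv_raw_close[OF assms(1), of "[]" "[]" c] assms(2,3) by (simp add: raw_close_fresh)
  from conv_Lam[OF this] show ?thesis
    using conv_eta[OF assms(4)] conv_eta[OF assms(5)] by (blast intro: conv_trans conv_sym)
qed


subsection \<open>Algorithmic equality\<close>

text \<open>Weak head reduction. Its determinism makes the head form of a middle term unique, on
  which transitivity of algorithmic equality rests.\<close>

inductive whr :: "'k raw \<Rightarrow> 'k raw \<Rightarrow> bool" where
  whr_beta: "whr (App (Lam A r) u) (inst 0 u r)"
| whr_App: "whr r r' \<Longrightarrow> whr (App r u) (App r' u)"

inductive_cases whr_AppE: "whr (App r u) v"
inductive_cases whr_LamE: "whr (Lam A r) v"

lemma whr_deterministic: "whr r p \<Longrightarrow> whr r q \<Longrightarrow> p = q"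
proof (induction arbitrary: q rule: whr.induct)
  case (whr_beta A r u)
  then show ?case by (rule whr_AppE) (auto elim: whr_LamE)
next
  case (whr_App r r' u)
  from whr_App.prems show ?case
  proof (rule whr_AppE)
    fix A w
    assume "r = Lam A w"
    with whr_App.hyps show ?thesis by (auto elim: whr_LamE)
  next
    fix r''
    assume "q = App r'' u" "whr r r''"
    with whr_App.IH show ?thesis by blast
  qed
qed

text \<open>At function type the premise covers all constants of the argument type instead of one
  fresh constant. No freshness condition then burdens symmetry and transitivity, and an induction
  may pick a constant that avoids any given finite set.\<close>

inductive alg_eq :: "ty \<Rightarrow> 'k::signature raw \<Rightarrow> 'k raw \<Rightarrow> bool"
  and neutral_eq :: "ty \<Rightarrow> 'k raw \<Rightarrow> 'k raw \<Rightarrow> bool" where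
  alg_Base: "whr\<^sup>*\<^sup>* s p \<Longrightarrow> whr\<^sup>*\<^sup>* t q \<Longrightarrow> neutral_eq (Base i) p q \<Longrightarrow> alg_eq (Base i) s t"
| alg_Fun: "(\<And>c. nty c = A \<Longrightarrow> alg_eq B (App s (Nom c)) (App t (Nom c))) \<Longrightarrow> alg_eq (Fun A B) s t"
| neutral_Free: "neutral_eq (vty x) (Free x) (Free x)"
| neutral_Nom: "neutral_eq (nty c) (Nom c) (Nom c)"
| neutral_Cst: "const_ty k = Some A \<Longrightarrow> neutral_eq A (Cst k) (Cst k)"
| neutral_App: "neutral_eq (Fun A B) p q \<Longrightarrow> alg_eq A u v \<Longrightarrow> neutral_eq B (App p u) (App q v)"

inductive_cases alg_BaseE: "alg_eq (Base i) s t"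
inductive_cases alg_FunE: "alg_eq (Fun A B) s t"
inductive_cases neutral_FreeE: "neutral_eq A (Free x) t"
inductive_cases neutral_NomE: "neutral_eq A (Nom c) t"
inductive_cases neutral_CstE: "neutral_eq A (Cst k) t"
inductive_cases neutral_AppE: "neutral_eq A (App p u) t"

lemma alg_neutral_sym:
  "alg_eq A s t \<Longrightarrow> alg_eq A t s"
  "neutral_eq A s t \<Longrightarrow> neutral_eq A t s"
  by (induction rule: alg_eq_neutral_eq.inducts) (auto intro: alg_eq_neutral_eq.intros)

text \<open>Excluding abstractions rules out a \<beta>-step at the head of the next application,
  which carries the induction. The clause \<open>True\<close> is the companion claim that the mutual
  rule asks for.\<close>

lemma neutral_whr:
  "alg_eq A (s :: 'k::signature raw) t \<Longrightarrow> True"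
  "neutral_eq A (p :: 'k::signature raw) q \<Longrightarrow> \<not> whr p v \<and> \<not> (\<exists>C r. p = Lam C r)"
proof (induction A s t and A p q arbitrary: and v rule: alg_eq_neutral_eq.inducts)
  case (neutral_App A B p q u w)
  then show ?case by (auto elim: whr_AppE)
qed (auto elim: whr.cases)

lemma whr_rtrancl_neutral_unique:
  assumes "whr\<^sup>*\<^sup>* s p" "whr\<^sup>*\<^sup>* s q" "\<And>v. \<not> whr p v" "\<And>v. \<not> whr q v"
  shows "p = q"
  using assms
proof (induction rule: converse_rtranclp_induct)
  case base
  then show ?case by (metis converse_rtranclpE)
next
  case (step s s')
  then show ?case by (metis converse_rtranclpE whr_deterministic)
qed

text \<open>For neutral terms the type of the second derivation is left open: the head determines
  it, and for an application the argument type becomes known only through the induction hypothesis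
  for the function parts.\<close>

lemma alg_neutral_trans:
  "alg_eq A s t \<Longrightarrow> alg_eq A t u \<Longrightarrow> alg_eq A s u"
  "neutral_eq A s t \<Longrightarrow> neutral_eq A' t u \<Longrightarrow> A' = A \<and> neutral_eq A s u"
proof (induction arbitrary: u and A' u rule: alg_eq_neutral_eq.inducts)
  case (alg_Base s p t q i)
  from alg_Base.prems obtain q' r where
    *: "whr\<^sup>*\<^sup>* t q'" "whr\<^sup>*\<^sup>* u r" "neutral_eq (Base i) q' r" by (rule alg_BaseE)
  have "q' = q"
    using whr_rtrancl_neutral_unique[OF *(1) alg_Base.hyps(2)] neutral_whr(2)[OF *(3)]
      neutral_whr(2)[OF alg_neutral_sym(2)[OF alg_Base.hyps(3)]] by blast
  with * alg_Base show ?case by (blast intro: alg_eq_neutral_eq.alg_Base)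
next
  case (alg_Fun A B s t)
  then show ?case by (blast intro: alg_eq_neutral_eq.alg_Fun elim: alg_FunE)
next
  case (neutral_App A B p q u v A' w)
  from neutral_App.prems obtain C q' v' where
    *: "w = App q' v'" "neutral_eq (Fun C A') q q'" "alg_eq C v v'" by (rule neutral_AppE)
  from neutral_App.IH(1)[OF *(2)] have "A' = B" "C = A" "neutral_eq (Fun A B) p q'" by auto
  with * neutral_App.IH(2) show ?case by (blast intro: alg_eq_neutral_eq.neutral_App)
qed (auto elim: neutral_FreeE neutral_NomE neutral_CstE intro: alg_eq_neutral_eq.intros)


subsection \<open>Completeness of algorithmic equality\<close>

text \<open>Arguments are restricted to well-typed closed terms because they are later collected
  into the instantiations \<open>us\<close>, whose entries \<open>insts\<close> puts under binders
  unlifted.\<close>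

primrec log_rel :: "ty \<Rightarrow> 'k::signature raw \<Rightarrow> 'k raw \<Rightarrow> bool" where
  "log_rel (Base i) s t \<longleftrightarrow> alg_eq (Base i) s t"
| "log_rel (Fun A B) s t \<longleftrightarrow>
    (\<forall>u v. tyof [] u = Some A \<longrightarrow> tyof [] v = Some A \<longrightarrow> log_rel A u v \<longrightarrow>
      log_rel B (App s u) (App t v))"

lemma log_rel_sym: "log_rel A s t \<Longrightarrow> log_rel A t s"
  by (induction A arbitrary: s t) (auto intro: alg_neutral_sym)

lemma log_rel_trans: "log_rel A s t \<Longrightarrow> log_rel A t u \<Longrightarrow> log_rel A s u"
proof (induction A arbitrary: s t u)
  case (Base i)
  then show ?case by (auto intro: alg_neutral_trans)
next
  case (Fun A B)
  have "log_rel B (App s a) (App u b)"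
    if ab: "tyof [] a = Some A" "tyof [] b = Some A" "log_rel A a b" for a b
  proof -
    \<comment> \<open>Symmetry and transitivity at \<open>A\<close> relate \<open>b\<close> to
      itself, so the second comparison can use \<open>b\<close> on both sides.\<close>
    have "log_rel A b b" using Fun.IH(1)[OF log_rel_sym[OF ab(3)] ab(3)] .
    then have "log_rel B (App s a) (App t b)" "log_rel B (App t b) (App u b)"
      using Fun.prems ab by auto
    then show ?thesis by (rule Fun.IH(2))
  qed
  then show ?case by simp
qed

lemma log_rel_expand: "whr s s' \<Longrightarrow> log_rel A s' t \<Longrightarrow> log_rel A s t"
proof (induction A arbitrary: s s' t)
  case (Base i)
  then show ?case
    by (auto elim!: alg_BaseE intro: alg_Base converse_rtranclp_into_rtranclp)
next
  case (Fun A B)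
  show ?case
    using Fun.prems(2) Fun.IH(2)[OF whr_App[OF Fun.prems(1)]] by auto
qed

text \<open>Both directions share one induction since the argument type is contravariant: at
  \<open>Fun A B\<close>, reaching \<open>alg_eq\<close> needs the constants of type
  \<open>A\<close> to be related, while relating neutral terms needs \<open>alg_eq\<close> for
  arguments of type \<open>A\<close>.\<close>

lemma log_rel_reflect_reify:
  fixes p q s t :: "'k::signature raw"
  shows "(neutral_eq A p q \<longrightarrow> log_rel A p q) \<and> (log_rel A s t \<longrightarrow> alg_eq A s t)"
proof (induction A arbitrary: p q s t)
  case (Base i)
  then show ?case by (auto intro: alg_Base)
next
  case (Fun A B)
  have "log_rel A (Nom c :: 'k raw) (Nom c)" if "nty c = A" for c
    using Fun.IH(1) that by (blast intro: neutral_Nom)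
  then have "alg_eq (Fun A B) s t" if "log_rel (Fun A B) s t"
    using that Fun.IH(2) by (intro alg_Fun) simp
  moreover have "log_rel (Fun A B) p q" if "neutral_eq (Fun A B) p q"
    using that Fun.IH by (simp, blast intro: neutral_App)
  ultimately show ?case by blast
qed

lemmas log_rel_neutral = log_rel_reflect_reify[THEN conjunct1, rule_format]
lemmas log_rel_reify = log_rel_reflect_reify[THEN conjunct2, rule_format]

text \<open>The instantiating terms \<open>us\<close> are closed, so they are not lifted under binders.\<close>

primrec insts :: "nat \<Rightarrow> 'k raw list \<Rightarrow> 'k raw \<Rightarrow> 'k raw" where
  "insts k us (Bnd i) = (if i < k then Bnd i else if i - k < length us then us ! (i - k) else Bnd (i - length us))"
| "insts k us (Free x) = Free x"
| "insts k us (Nom c) = Nom c"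
| "insts k us (Cst a) = Cst a"
| "insts k us (App r u) = App (insts k us r) (insts k us u)"
| "insts k us (Lam A r) = Lam A (insts (Suc k) us r)"

abbreviation closed_list :: "ty list \<Rightarrow> 'k::signature raw list \<Rightarrow> bool" where
  "closed_list \<Gamma> us \<equiv> list_all2 (\<lambda>A u. tyof [] u = Some A) \<Gamma> us"

lemma insts_Nil [simp]: "insts k [] r = r"
  by (induction r arbitrary: k) auto

lemma tyof_insts:
  "tyof (\<Delta> @ \<Gamma>) r = Some A \<Longrightarrow> closed_list \<Gamma> us \<Longrightarrow> tyof \<Delta> (insts (length \<Delta>) us r) = Some A"
proof (induction r arbitrary: \<Delta> A)
  case (Bnd i)
  show ?case
  proof (cases "i < length \<Delta>")
    case False
    with Bnd have "tyof [] (us ! (i - length \<Delta>)) = Some A" "i - length \<Delta> < length us"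
      by (auto simp: nth_append list_all2_conv_all_nth split: if_splits)
    with False tyof_closed[OF this(1)] show ?thesis by simp
  qed (use Bnd in \<open>auto simp: nth_append split: if_splits\<close>)
next
  case (App r u)
  then show ?case by fastforce
next
  case (Lam C r)
  then show ?case using Lam.IH[of "C # \<Delta>"] by fastforce
qed auto

lemma closed_list_nth:
  assumes "closed_list \<Gamma> us" "i < length us"
  shows "lift k (us ! i) = us ! i" "inst k w (us ! i) = us ! i" 
  using assms lift_above[of "[]" "us ! i"] inst_above[of "[]" "us ! i"]
  by (auto simp: list_all2_conv_all_nth)

lemma inst_insts:
  assumes "closed_list \<Gamma> us" "tyof [] u = Some A"
  shows "inst k u (insts (Suc k) us r) = insts k (u # us) r"
proof -
  have "lift j u = u" for j using lift_above[OF assms(2)] by simp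
  then show ?thesis
  proof (induction r arbitrary: k)
    case (Bnd i)
    show ?case
    proof (cases "i \<le> k")
      case False
      then obtain j where "i = Suc (k + j)" by (metis less_imp_Suc_add not_le)
      then show ?thesis by (auto simp: closed_list_nth[OF assms(1)])
    qed auto
  qed auto
qed

lemma insts_lift:
  assumes "closed_list \<Gamma> us"
  shows "j \<le> k \<Longrightarrow> insts (Suc k) us (lift j r) = lift j (insts k us r)"
proof (induction r arbitrary: j k)
  case (Bnd i)
  show ?case
  proof (cases "i < k")
    case False
    then obtain l where "i = k + l" by (metis le_add_diff_inverse not_less)
    then show ?thesis using Bnd by (auto simp: closed_list_nth[OF assms])
  qed (use Bnd in auto)
qed auto

lemma insts_inst:
  assumes "closed_list \<Gamma> us"
  shows "insts k us (inst k w r) = inst k (insts k us w) (insts (Suc k) us r)"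
proof (induction r arbitrary: k w)
  case (Bnd i)
  show ?case
  proof (cases "i \<le> k")
    case False
    then obtain j where "i = Suc (k + j)" by (metis less_imp_Suc_add not_le)
    then show ?thesis by (auto simp: closed_list_nth[OF assms])
  qed auto
qed (auto simp: insts_lift[OF assms])

definition log_rel_list :: "ty list \<Rightarrow> 'k::signature raw list \<Rightarrow> 'k raw list \<Rightarrow> bool" where
  "log_rel_list \<Gamma> us vs \<longleftrightarrow> closed_list \<Gamma> us \<and> closed_list \<Gamma> vs \<and>
    (\<forall>i < length \<Gamma>. log_rel (\<Gamma> ! i) (us ! i) (vs ! i))"

lemma log_rel_list_Cons:
  "tyof [] u = Some A \<Longrightarrow> tyof [] v = Some A \<Longrightarrow> log_rel A u v \<Longrightarrow> log_rel_list \<Gamma> us vs \<Longrightarrow>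
   log_rel_list (A # \<Gamma>) (u # us) (v # vs)"
  by (auto simp: log_rel_list_def nth_Cons split: nat.splits)

lemma log_rel_list_sym: "log_rel_list \<Gamma> us vs \<Longrightarrow> log_rel_list \<Gamma> vs us"
  by (auto simp: log_rel_list_def intro: log_rel_sym)

lemma log_rel_list_refl: "log_rel_list \<Gamma> us vs \<Longrightarrow> log_rel_list \<Gamma> vs vs"
  by (auto simp: log_rel_list_def intro: log_rel_sym log_rel_trans)

lemma tyof_insts_closed:
  assumes "log_rel_list \<Gamma> us vs" "tyof \<Gamma> r = Some A"
  shows "tyof [] (insts 0 us r) = Some A" "tyof [] (insts 0 vs r) = Some A"
  using assms tyof_insts[of "[]" \<Gamma> r A] by (auto simp: log_rel_list_def)

lemma log_rel_expand2:
  "whr s s' \<Longrightarrow> whr t t' \<Longrightarrow> log_rel A s' t' \<Longrightarrow> log_rel A s t"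
  using log_rel_expand log_rel_sym by blast

lemma whr_insts_beta:
  assumes "closed_list \<Gamma> us" "tyof [] u = Some A"
  shows "whr (App (insts 0 us (Lam B r)) u) (insts 0 (u # us) r)"
  using whr_beta[of B "insts (Suc 0) us r" u] inst_insts[OF assms, of 0 r] by simp

text \<open>Fundamental lemma for a single term. It precedes the one for conversion because
  reflexivity, \<beta> and \<eta> come with typing premises only, hence without induction
  hypotheses.\<close>

lemma log_rel_tyof:
  "tyof \<Gamma> r = Some A \<Longrightarrow> log_rel_list \<Gamma> us vs \<Longrightarrow> log_rel A (insts 0 us r) (insts 0 vs r)"
proof (induction r arbitrary: \<Gamma> A us vs)
  case (Bnd i)
  then show ?case by (auto simp: log_rel_list_def list_all2_conv_all_nth split: if_splits)
next
  case (Free x)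
  then show ?case by (auto intro: log_rel_neutral neutral_Free)
next
  case (Nom c)
  then show ?case by (auto intro: log_rel_neutral neutral_Nom)
next
  case (Cst k)
  then show ?case by (auto intro: log_rel_neutral neutral_Cst)
next
  case (App r u)
  then obtain B where B: "tyof \<Gamma> r = Some (Fun B A)" "tyof \<Gamma> u = Some B" by auto
  from App.IH(1)[OF B(1) App.prems(2)] App.IH(2)[OF B(2) App.prems(2)]
    tyof_insts_closed[OF App.prems(2) B(2)]
  show ?case by simp
next
  case (Lam C r)
  then obtain B where B: "tyof (C # \<Gamma>) r = Some B" "A = Fun C B" by auto
  have "log_rel B (App (insts 0 us (Lam C r)) u) (App (insts 0 vs (Lam C r)) v)"
    if uv: "tyof [] u = Some C" "tyof [] v = Some C" "log_rel C u v" for u v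
  proof (rule log_rel_expand2)
    show "whr (App (insts 0 us (Lam C r)) u) (insts 0 (u # us) r)"
      "whr (App (insts 0 vs (Lam C r)) v) (insts 0 (v # vs) r)"
      using Lam.prems(2) uv by (auto simp del: insts.simps simp: log_rel_list_def intro: whr_insts_beta)
    show "log_rel B (insts 0 (u # us) r) (insts 0 (v # vs) r)"
      by (rule Lam.IH[OF B(1) log_rel_list_Cons[OF uv Lam.prems(2)]])
  qed
  with B(2) show ?case by (simp del: insts.simps)
qed

lemma log_rel_conv:
  "conv \<Gamma> A r r' \<Longrightarrow> log_rel_list \<Gamma> us vs \<Longrightarrow> log_rel A (insts 0 us r) (insts 0 vs r')"
proof (induction arbitrary: us vs rule: conv.induct)
  case (conv_refl \<Gamma> r A)
  then show ?case by (rule log_rel_tyof)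
next
  case (conv_sym \<Gamma> A r r')
  then show ?case by (blast intro: log_rel_sym log_rel_list_sym)
next
  case (conv_trans \<Gamma> A r r' r'')
  then show ?case by (blast intro: log_rel_trans log_rel_list_refl)
next
  case (conv_App \<Gamma> A B r r' u u')
  from conv_App.IH(1)[OF conv_App.prems] conv_App.IH(2)[OF conv_App.prems]
    tyof_insts_closed[OF conv_App.prems, of u A] tyof_insts_closed[OF conv_App.prems, of u' A]
    conv_tyof[OF conv_App.hyps(2)]
  show ?case by simp
next
  case (conv_Lam A \<Gamma> B r r')
  have "log_rel B (App (insts 0 us (Lam A r)) u) (App (insts 0 vs (Lam A r')) v)"
    if uv: "tyof [] u = Some A" "tyof [] v = Some A" "log_rel A u v" for u v
  proof (rule log_rel_expand2)
    show "whr (App (insts 0 us (Lam A r)) u) (insts 0 (u # us) r)"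
      "whr (App (insts 0 vs (Lam A r')) v) (insts 0 (v # vs) r')"
      using conv_Lam.prems uv
      by (auto simp del: insts.simps simp: log_rel_list_def intro: whr_insts_beta)
    show "log_rel B (insts 0 (u # us) r) (insts 0 (v # vs) r')"
      by (rule conv_Lam.IH[OF log_rel_list_Cons[OF uv conv_Lam.prems]])
  qed
  then show ?case by (simp del: insts.simps)
next
  case (conv_beta A \<Gamma> r B u)
  have cl: "closed_list \<Gamma> us" "closed_list \<Gamma> vs"
    using conv_beta.prems by (auto simp: log_rel_list_def)
  note ty = tyof_insts_closed[OF conv_beta.prems conv_beta.hyps(2)]
  have "insts 0 vs (inst 0 u r) = insts 0 (insts 0 vs u # vs) r"
    using insts_inst[OF cl(2), of 0 u r] inst_insts[OF cl(2) ty(2), of 0 r] by simp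
  moreover have "log_rel B (insts 0 (insts 0 us u # us) r) (insts 0 (insts 0 vs u # vs) r)"
    by (intro log_rel_tyof[OF conv_beta.hyps(1)] log_rel_list_Cons ty conv_beta.prems
        log_rel_tyof[OF conv_beta.hyps(2)])
  ultimately show ?case
    using log_rel_expand[OF whr_insts_beta[OF cl(1) ty(1), of A r]] by simp
next
  case (conv_eta \<Gamma> r A B)
  have cl: "closed_list \<Gamma> us" using conv_eta.prems by (auto simp: log_rel_list_def)
  note ty = tyof_insts_closed(1)[OF conv_eta.prems conv_eta.hyps]
  \<comment> \<open>An instantiated \<open>r\<close> is closed, so the lifting in the
    \<eta>-expansion is invisible, and the expansion applied to \<open>u\<close> takes one head step
    to the instance of \<open>r\<close> applied to \<open>u\<close>.\<close>
  have "insts (Suc 0) us (lift 0 r) = insts 0 us r"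
    using insts_lift[OF cl, of 0 0 r] lift_above[OF ty, of 0] by simp
  then have *: "whr (App (insts 0 us (Lam A (App (lift 0 r) (Bnd 0)))) u) (App (insts 0 us r) u)" for u
    using whr_beta[of A "App (insts 0 us r) (Bnd 0)" u] inst_above[OF ty, of 0 u] by simp
  have "log_rel (Fun A B) (insts 0 us r) (insts 0 vs r)"
    by (rule log_rel_tyof[OF conv_eta.hyps conv_eta.prems])
  then show ?case using log_rel_expand[OF *] by (simp del: insts.simps)
qed

lemma conv_imp_alg_eq: "conv [] A r r' \<Longrightarrow> alg_eq A r r'"
  using log_rel_conv[of "[]" A r r' "[]" "[]"]
  by (auto simp: log_rel_list_def intro: log_rel_reify)


subsection \<open>Identifying nominal constants\<close>

lemma noms_whr: "whr r r' \<Longrightarrow> noms r' \<subseteq> noms r"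
  by (induction rule: whr.induct) (use noms_inst in fastforce)+

lemma whr_conv: "whr r r' \<Longrightarrow> tyof \<Gamma> r = Some A \<Longrightarrow> conv \<Gamma> A r r'"
  by (induction arbitrary: A rule: whr.induct) (auto intro: conv.conv_beta conv_App conv_refl)

lemma whr_rtrancl_conv: "whr\<^sup>*\<^sup>* r r' \<Longrightarrow> tyof \<Gamma> r = Some A \<Longrightarrow> conv \<Gamma> A r r'"
proof (induction rule: rtranclp_induct)
  case base
  then show ?case by (rule conv_refl)
next
  case (step p q)
  then show ?case using whr_conv conv_tyof conv_trans by metis
qed

lemma noms_whr_rtrancl: "whr\<^sup>*\<^sup>* r r' \<Longrightarrow> noms r' \<subseteq> noms r"
  by (induction rule: rtranclp_induct) (auto dest: noms_whr)

lemma raw_perm_lift: "raw_perm \<delta> (lift k r) = lift k (raw_perm \<delta> r)"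
  by (induction r arbitrary: k) auto

lemma raw_perm_inst: "raw_perm \<delta> (inst k w r) = inst k (raw_perm \<delta> w) (raw_perm \<delta> r)"
  by (induction r arbitrary: k w) (auto simp: raw_perm_lift)

lemma raw_perm_eq_App:
  "raw_perm \<delta> s = App p u \<longleftrightarrow> (\<exists>s1 s2. s = App s1 s2 \<and> p = raw_perm \<delta> s1 \<and> u = raw_perm \<delta> s2)"
  by (cases s) auto

lemma raw_perm_eq_Lam: "raw_perm \<delta> s = Lam A p \<longleftrightarrow> (\<exists>r. s = Lam A r \<and> p = raw_perm \<delta> r)"
  by (cases s) auto

text \<open>Injectivity of \<delta> is not assumed: constants become constants, so renaming creates
  no redex that was not there before.\<close>

lemma whr_raw_perm_reflect: "whr p q \<Longrightarrow> p = raw_perm \<delta> s \<Longrightarrow> \<exists>s'. whr s s' \<and> q = raw_perm \<delta> s'"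
proof (induction arbitrary: s rule: whr.induct)
  case (whr_beta A r u)
  then obtain r' u' where "s = App (Lam A r') u'" "r = raw_perm \<delta> r'" "u = raw_perm \<delta> u'"
    by (metis raw_perm_eq_App raw_perm_eq_Lam)
  then show ?case by (metis raw_perm_inst whr.whr_beta)
next
  case (whr_App r r' u)
  then obtain s1 s2 where "s = App s1 s2" "r = raw_perm \<delta> s1" "u = raw_perm \<delta> s2"
    by (metis raw_perm_eq_App)
  then show ?case using whr_App.IH by (metis raw_perm.simps(5) whr.whr_App)
qed

lemma whr_rtrancl_raw_perm_reflect:
  "whr\<^sup>*\<^sup>* (raw_perm \<delta> s) q \<Longrightarrow> \<exists>s'. whr\<^sup>*\<^sup>* s s' \<and> q = raw_perm \<delta> s'"
proof (induction rule: rtranclp_induct)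
  case base
  then show ?case by blast
next
  case (step p q)
  then show ?case by (metis rtranclp.rtrancl_into_rtrancl whr_raw_perm_reflect)
qed

lemma ex_fresh_nom: "finite X \<Longrightarrow> \<exists>c. nty c = A \<and> c \<notin> X"
proof (rule ccontr)
  assume "finite X" and "\<not> (\<exists>c. nty c = A \<and> c \<notin> X)"
  then have "range (\<lambda>n. N n A) \<subseteq> X" by auto
  with \<open>finite X\<close> have "finite (range (\<lambda>n. N n A))" by (rule rev_finite_subset)
  moreover have "inj (\<lambda>n. N n A)" by (rule injI) simp
  ultimately show False using finite_imageD by fastforce
qed

text \<open>
  Algorithmic equality never inspects which nominal constants are equal beyond matching the atoms
  of the two sides, so a computation on the identified term lifts to the original one as long as
  the other side mentions none of the identified constants.
\<close>

lemma alg_neutral_identify: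
  assumes "finite {c. \<delta> c \<noteq> c}"
  shows
  "alg_eq A p t \<Longrightarrow> p = raw_perm \<delta> s \<Longrightarrow> tyof [] s = Some A \<Longrightarrow> tyof [] t = Some A \<Longrightarrow>
     (\<forall>c. \<delta> c \<noteq> c \<longrightarrow> \<delta> c \<notin> noms t) \<Longrightarrow> conv [] A s t"
  "neutral_eq A p t \<Longrightarrow> p = raw_perm \<delta> s \<Longrightarrow> tyof [] s \<noteq> None \<Longrightarrow> tyof [] t \<noteq> None \<Longrightarrow>
     (\<forall>c. \<delta> c \<noteq> c \<longrightarrow> \<delta> c \<notin> noms t) \<Longrightarrow> conv [] A s t"
proof (induction A p t and A p t arbitrary: s and s rule: alg_eq_neutral_eq.inducts)
  case (alg_Base r p t q i)
  obtain s' where s': "whr\<^sup>*\<^sup>* s s'" "p = raw_perm \<delta> s'"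
    using alg_Base.hyps(1) alg_Base.prems(1) whr_rtrancl_raw_perm_reflect by blast
  have c: "conv [] (Base i) s s'" "conv [] (Base i) t q"
    using whr_rtrancl_conv s'(1) alg_Base by blast+
  have "conv [] (Base i) s' q"
  proof (rule alg_Base.IH[OF s'(2)])
    show "tyof [] s' \<noteq> None" "tyof [] q \<noteq> None" using c conv_tyof by fastforce+
    show "\<forall>c. \<delta> c \<noteq> c \<longrightarrow> \<delta> c \<notin> noms q"
      using alg_Base.prems(4) noms_whr_rtrancl[OF alg_Base.hyps(2)] by blast
  qed
  with c show ?case by (meson conv_sym conv_trans)
next
  case (alg_Fun A B p t)
  \<comment> \<open>As \<open>c\<close> is neither moved by \<delta> nor the image of a moved
    constant, applying both sides to it keeps the left one a \<delta>-image and preserves the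
    condition on the right one. Freshness for \<open>s\<close> and \<open>t\<close> permits
    \<open>conv_ext\<close>.\<close>
  obtain c where c: "nty c = A" "c \<notin> noms s \<union> noms t \<union> {c. \<delta> c \<noteq> c} \<union> \<delta> ` {c. \<delta> c \<noteq> c}"
    using ex_fresh_nom[of "noms s \<union> noms t \<union> {c. \<delta> c \<noteq> c} \<union> \<delta> ` {c. \<delta> c \<noteq> c}" A] assms
    by auto
  have "conv [] B (App s (Nom c)) (App t (Nom c))"
    using alg_Fun.prems c by (intro alg_Fun.IH[OF c(1)]) auto
  with c alg_Fun.prems show ?case by (auto intro: conv_ext)
next
  case (neutral_Free x)
  then have "s = Free x" by (cases s) auto
  then show ?case by (auto intro: conv_refl)
next
  case (neutral_Nom c)
  \<comment> \<open>The decisive case: were \<open>s = Nom d\<close> with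
    \<open>\<delta> d = c\<close> and \<open>d\<close> different from \<open>c\<close>, then
    \<open>c\<close> would be an image that the right-hand side must not contain.\<close>
  then have "s = Nom c" by (cases s) (auto, metis)
  then show ?case by (auto intro: conv_refl)
next
  case (neutral_Cst k A)
  then have "s = Cst k" by (cases s) auto
  with neutral_Cst show ?case by (auto intro: conv_refl)
next
  case (neutral_App A B p q u v)
  then obtain s1 s2 where s: "s = App s1 s2" "p = raw_perm \<delta> s1" "u = raw_perm \<delta> s2"
    by (metis raw_perm_eq_App)
  obtain C D where ty: "tyof [] s1 = Some (Fun C D)" "tyof [] s2 = Some C"
    using neutral_App.prems(2) s(1) by auto
  obtain C' D' where ty': "tyof [] q = Some (Fun C' D')" "tyof [] v = Some C'"
    using neutral_App.prems(3) by auto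
  \<comment> \<open>The neutral claim assumes only some type for each side; conversion of the heads
    then yields the argument type that the claim for the arguments requires.\<close>
  have "conv [] (Fun A B) s1 q"
    using neutral_App.prems(4) ty ty' by (intro neutral_App.IH(1)[OF s(2)]) auto
  with ty ty' have "C = A" "C' = A" using conv_tyof by fastforce+
  then have "conv [] A s2 v"
    using neutral_App.prems(4) ty ty' by (intro neutral_App.IH(2)[OF s(3)]) auto
  with \<open>conv [] (Fun A B) s1 q\<close> s(1) show ?case by (auto intro: conv_App)
qed

lemma conv_identify:
  assumes "finite {c. \<delta> c \<noteq> c}" "conv [] A (raw_perm \<delta> s) t" "tyof [] s = Some A"
    and "\<And>c. \<delta> c \<noteq> c \<Longrightarrow> \<delta> c \<notin> noms t"
  shows "conv [] A s t"
  using alg_neutral_identify(1)[OF assms(1) conv_imp_alg_eq[OF assms(2)] refl assms(3)]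
    assms(4) conv_tyof[OF assms(2)] by blast


subsection \<open>Operations on terms\<close>

lemma eqv_tyof: "eqv r r' \<Longrightarrow> tyof [] r' = tyof [] r \<and> tyof [] r \<noteq> None"
  using conv_tyof unfolding eqv_def by fastforce

lemma eqv_iff_conv: "tyof [] r = Some A \<Longrightarrow> eqv r r' \<longleftrightarrow> conv [] A r r'"
  using conv_tyof unfolding eqv_def by fastforce

lemma eqv_rep_tm: "eqv (rep_tm t) (rep_tm t)"
  by (rule Quotient3_rep_reflp[OF Quotient3_tm])

lemma eqv_rep_tm_iff: "eqv (rep_tm t) r \<longleftrightarrow> tyof [] r \<noteq> None \<and> abs_tm r = t"
proof
  assume "eqv (rep_tm t) r"
  then show "tyof [] r \<noteq> None \<and> abs_tm r = t"
    using eqv_tyof Quotient3_rel_abs[OF Quotient3_tm] Quotient3_abs_rep[OF Quotient3_tm] by metis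
next
  assume r: "tyof [] r \<noteq> None \<and> abs_tm r = t"
  then have "eqv r r" by (auto simp: eqv_def intro: conv_refl)
  with r show "eqv (rep_tm t) r"
    using Quotient3_rel[OF Quotient3_tm] eqv_rep_tm Quotient3_abs_rep[OF Quotient3_tm] by metis
qed

lemma tyof_rep_tm: "tyof [] (rep_tm t) = Some (tm_ty t)"
  using eqv_tyof[OF eqv_rep_tm[of t]] by (auto simp: tm_ty_def)

lemma abs_rep_tm [simp]: "abs_tm (rep_tm t) = t"
  by (rule Quotient3_abs_rep[OF Quotient3_tm])

lemma tm_ty_abs: "tyof [] r = Some A \<Longrightarrow> tm_ty (abs_tm r) = A"
  by (metis eqv_rep_tm_iff eqv_tyof option.distinct(1) option.inject tyof_rep_tm)

lemma conv_rep_abs: "tyof [] r = Some A \<Longrightarrow> conv [] A (rep_tm (abs_tm r)) r"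
  by (metis eqv_iff_conv eqv_rep_tm_iff option.distinct(1) tm_ty_abs tyof_rep_tm)

lemma abs_tm_eq: "conv [] A r r' \<Longrightarrow> abs_tm r = abs_tm r'"
  using Quotient3_rel_abs[OF Quotient3_tm] eqv_def by blast

lemma abs_tm_eqD:
  assumes "abs_tm r = abs_tm r'" "tyof [] r = Some A" "tyof [] r' = Some B"
  shows "conv [] A r r'"
proof -
  have "conv [] A (rep_tm (abs_tm r)) r" "conv [] B (rep_tm (abs_tm r)) r'"
    using conv_rep_abs[OF assms(2)] conv_rep_abs[OF assms(3)] assms(1) by simp_all
  moreover from this have "A = B" by (metis conv_tyof option.inject)
  ultimately show ?thesis by (meson conv_sym conv_trans)
qed

definition tm_nom :: "nom \<Rightarrow> 'k::signature tm" where
  "tm_nom c = abs_tm (Nom c)"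

definition tm_app :: "'k::signature tm \<Rightarrow> 'k tm \<Rightarrow> 'k tm" where
  "tm_app t u = abs_tm (App (rep_tm t) (rep_tm u))"

definition tm_map :: "(nom \<Rightarrow> 'k::signature tm) \<Rightarrow> 'k subst \<Rightarrow> 'k tm \<Rightarrow> 'k tm" where
  "tm_map f \<theta> t = abs_tm (raw_map (\<lambda>c. rep_tm (f c)) (\<lambda>x. rep_tm (\<theta> x)) (rep_tm t))"

definition tm_typed :: "(nom \<Rightarrow> 'k::signature tm) \<Rightarrow> 'k subst \<Rightarrow> bool" where
  "tm_typed f \<theta> \<longleftrightarrow> (\<forall>c. tm_ty (f c) = nty c) \<and> (\<forall>x. tm_ty (\<theta> x) = vty x)"

lemma tm_ty_nom [simp]: "tm_ty (tm_nom c) = nty c"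
  by (simp add: tm_nom_def tm_ty_abs)

lemma tm_ty_var [simp]: "tm_ty (tm_var x) = vty x"
  by (simp add: tm_var_def tm_ty_abs)

lemma tm_app_abs:
  assumes "tyof [] r = Some (Fun A B)" "tyof [] u = Some A"
  shows "tm_app (abs_tm r) (abs_tm u) = abs_tm (App r u)"
  unfolding tm_app_def by (rule abs_tm_eq conv_App conv_rep_abs assms)+

lemma tm_ty_app: "tm_ty t = Fun A B \<Longrightarrow> tm_ty u = A \<Longrightarrow> tm_ty (tm_app t u) = B"
  unfolding tm_app_def by (rule tm_ty_abs) (simp add: tyof_rep_tm)

lemma tm_map_abs:
  assumes "tyof [] r = Some A" "raw_typed f \<theta>"
  shows "tm_map (\<lambda>c. abs_tm (f c)) (\<lambda>x. abs_tm (\<theta> x)) (abs_tm r) = abs_tm (raw_map f \<theta> r)"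
proof -
  have "conv [] A (raw_map (\<lambda>c. rep_tm (abs_tm (f c))) (\<lambda>x. rep_tm (abs_tm (\<theta> x))) (rep_tm (abs_tm r)))
      (raw_map f \<theta> (rep_tm (abs_tm r)))"
    using assms by (intro raw_map_conv conv_rep_abs) (auto simp: tyof_rep_tm tm_ty_abs raw_typed_def)
  moreover have "conv [] A (raw_map f \<theta> (rep_tm (abs_tm r))) (raw_map f \<theta> r)"
    by (rule conv_raw_map[OF assms(2) conv_rep_abs[OF assms(1)]])
  ultimately show ?thesis unfolding tm_map_def by (rule abs_tm_eq[OF conv_trans])
qed

lemma raw_typed_rep: "tm_typed f \<theta> \<Longrightarrow> raw_typed (\<lambda>c. rep_tm (f c)) (\<lambda>x. rep_tm (\<theta> x))"
  by (simp add: raw_typed_def tm_typed_def tyof_rep_tm)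

lemma tm_map_abs':
  assumes "tyof [] r = Some A" "tm_typed f \<theta>"
  shows "tm_map f \<theta> (abs_tm r) = abs_tm (raw_map (\<lambda>c. rep_tm (f c)) (\<lambda>x. rep_tm (\<theta> x)) r)"
  using tm_map_abs[OF assms(1) raw_typed_rep[OF assms(2)]] by simp

lemma tm_ty_map: "tm_typed f \<theta> \<Longrightarrow> tm_ty (tm_map f \<theta> t) = tm_ty t"
  unfolding tm_map_def by (intro tm_ty_abs tyof_raw_map raw_typed_rep tyof_rep_tm)

lemma tm_map_nom [simp]: "tm_typed f \<theta> \<Longrightarrow> tm_map f \<theta> (tm_nom c) = f c"
  using tm_map_abs'[of "Nom c" "nty c"] by (simp add: tm_nom_def)

lemma tm_map_var [simp]: "tm_typed f \<theta> \<Longrightarrow> tm_map f \<theta> (tm_var x) = \<theta> x"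
  using tm_map_abs'[of "Free x" "vty x"] by (simp add: tm_var_def)

lemma tm_map_ident [simp]: "tm_map tm_nom tm_var t = t"
  using tm_map_abs[OF tyof_rep_tm[of t], of Nom Free]
  by (simp add: raw_typed_def tm_nom_def[abs_def] tm_var_def[abs_def])

lemma tm_map_app:
  assumes "tm_typed f \<theta>" "tm_ty t = Fun (tm_ty u) B"
  shows "tm_map f \<theta> (tm_app t u) = tm_app (tm_map f \<theta> t) (tm_map f \<theta> u)"
proof -
  let ?f = "\<lambda>c. rep_tm (f c)" and ?\<theta> = "\<lambda>x. rep_tm (\<theta> x)"
  have ty: "tyof [] (rep_tm t) = Some (Fun (tm_ty u) B)" "tyof [] (rep_tm u) = Some (tm_ty u)"
    by (simp_all add: tyof_rep_tm assms(2))
  have "tm_map f \<theta> (tm_app t u) = abs_tm (raw_map ?f ?\<theta> (App (rep_tm t) (rep_tm u)))"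
    unfolding tm_app_def using ty by (intro tm_map_abs'[OF _ assms(1)]) auto
  also have "\<dots> = tm_app (tm_map f \<theta> t) (tm_map f \<theta> u)"
    unfolding tm_map_def using tyof_raw_map[OF raw_typed_rep[OF assms(1)]] ty
    by (simp add: tm_app_abs)
  finally show ?thesis .
qed

lemma tm_typed_map:
  "tm_typed f \<theta> \<Longrightarrow> tm_typed g \<eta> \<Longrightarrow> tm_typed (\<lambda>c. tm_map f \<theta> (g c)) (\<lambda>x. tm_map f \<theta> (\<eta> x))"
  by (simp add: tm_typed_def tm_ty_map[unfolded tm_typed_def])

lemma tm_map_map:
  assumes "tm_typed f \<theta>" "tm_typed g \<eta>"
  shows "tm_map f \<theta> (tm_map g \<eta> t) = tm_map (\<lambda>c. tm_map f \<theta> (g c)) (\<lambda>x. tm_map f \<theta> (\<eta> x)) t"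
proof -
  let ?f = "\<lambda>c. rep_tm (f c)" and ?\<theta> = "\<lambda>x. rep_tm (\<theta> x)"
  let ?g = "\<lambda>c. rep_tm (g c)" and ?\<eta> = "\<lambda>x. rep_tm (\<eta> x)"
  have ty: "raw_typed ?f ?\<theta>" "raw_typed ?g ?\<eta>" using assms by (auto intro: raw_typed_rep)
  have "tm_map f \<theta> (tm_map g \<eta> t) = abs_tm (raw_map ?f ?\<theta> (raw_map ?g ?\<eta> (rep_tm t)))"
    unfolding tm_map_def[of g]
    by (rule tm_map_abs'[OF tyof_raw_map[OF ty(2) tyof_rep_tm] assms(1)])
  also have "\<dots> = tm_map (\<lambda>c. abs_tm (raw_map ?f ?\<theta> (?g c))) (\<lambda>x. abs_tm (raw_map ?f ?\<theta> (?\<eta> x)))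
      (abs_tm (rep_tm t))"
    unfolding raw_map_raw_map
    by (rule tm_map_abs[OF tyof_rep_tm, symmetric])
      (auto simp: raw_typed_def tyof_raw_map[OF ty(1)] raw_typed_closed[OF ty(2)])
  finally show ?thesis by (simp add: tm_map_def)
qed


subsection \<open>Support and free variables\<close>

lemma supp_subset_noms: "tyof [] r = Some A \<Longrightarrow> supp (abs_tm r) \<subseteq> noms r"
  using eqv_rep_tm_iff unfolding supp_def by fastforce

text \<open>
  If some representative avoids \<open>d\<close>, then replacing \<open>d\<close> by a variable in any other one stays in the
  same class. This gives representatives without vacuous constants and does not need normal forms.
\<close>

lemma supp_rep:
  obtains r where "tyof [] r = Some (tm_ty t)" "abs_tm r = t" "noms r = supp t"
proof -
  let ?P = "\<lambda>r. tyof [] r = Some (tm_ty t) \<and> abs_tm r = t"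
  have "?P (rep_tm t)" by (simp add: tyof_rep_tm)
  then obtain r where r: "?P r" and min: "\<And>r'. ?P r' \<Longrightarrow> card (noms r) \<le> card (noms r')"
    using arg_min_nat_lemma[of ?P _ "\<lambda>r. card (noms r)"] by blast
  have "noms r \<subseteq> supp t"
  proof
    fix d assume d: "d \<in> noms r"
    show "d \<in> supp t"
    proof (rule ccontr)
      assume "d \<notin> supp t"
      then obtain r' where r': "tyof [] r' \<noteq> None" "abs_tm r' = t" "d \<notin> noms r'"
        by (auto simp: supp_def eqv_rep_tm_iff)
      let ?m = "raw_map (Nom(d := Free (V 0 (nty d)))) Free"
      have ty: "raw_typed (Nom(d := Free (V 0 (nty d)))) Free" by (simp add: raw_typed_def)
      have "conv [] (tm_ty t) r r'" using r r' abs_tm_eqD[of r r' "tm_ty t"] by auto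
      from conv_raw_map[OF ty this] have "conv [] (tm_ty t) (?m r) (?m r')" .
      moreover have "?m r' = r'"
        using raw_map_cong[of r' "Nom(d := Free (V 0 (nty d)))" Nom Free Free] r'(3)
        by (metis fun_upd_other raw_map_ident)
      ultimately have "?P (?m r)" using r'(2) conv_tyof abs_tm_eq by metis
      moreover have "noms (?m r) = noms r - {d}" by (auto simp: noms_raw_map split: if_splits)
      ultimately show False using min[of "?m r"] card_Diff1_less[OF finite_noms d] by (metis leD)
    qed
  qed
  moreover have "supp t \<subseteq> noms r" using supp_subset_noms r by blast
  ultimately show ?thesis using that r by blast
qed

text \<open>As for constants with the roles exchanged: a vacuous variable is overwritten by a
  constant. Each construction may add symbols of the other kind, so no representative is claimed to
  be minimal for both.\<close>

lemma fv_rep: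
  obtains r where "tyof [] r = Some (tm_ty t)" "abs_tm r = t" "frees r \<subseteq> fv t"
proof -
  let ?P = "\<lambda>r. tyof [] r = Some (tm_ty t) \<and> abs_tm r = t"
  have "?P (rep_tm t)" by (simp add: tyof_rep_tm)
  then obtain r where r: "?P r" and min: "\<And>r'. ?P r' \<Longrightarrow> card (frees r) \<le> card (frees r')"
    using arg_min_nat_lemma[of ?P _ "\<lambda>r. card (frees r)"] by blast
  have "frees r \<subseteq> fv t"
  proof
    fix x assume x: "x \<in> frees r"
    show "x \<in> fv t"
    proof (rule ccontr)
      assume "x \<notin> fv t"
      then obtain r' where r': "tyof [] r' \<noteq> None" "abs_tm r' = t" "x \<notin> frees r'"
        by (auto simp: fv_def eqv_rep_tm_iff)
      let ?m = "raw_map Nom (Free(x := Nom (N 0 (vty x))))"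
      have ty: "raw_typed Nom (Free(x := Nom (N 0 (vty x))))" by (simp add: raw_typed_def)
      have "conv [] (tm_ty t) r r'" using r r' abs_tm_eqD[of r r' "tm_ty t"] by auto
      from conv_raw_map[OF ty this] have "conv [] (tm_ty t) (?m r) (?m r')" .
      moreover have "?m r' = r'"
        using raw_map_cong[of r' Nom Nom "Free(x := Nom (N 0 (vty x)))" Free] r'(3)
        by (metis fun_upd_other raw_map_ident)
      ultimately have "?P (?m r)" using r'(2) conv_tyof abs_tm_eq by metis
      moreover have "frees (?m r) = frees r - {x}" by (auto simp: frees_raw_map split: if_splits)
      ultimately show False using min[of "?m r"] card_Diff1_less[OF finite_frees x] by (metis leD)
    qed
  qed
  with that r show ?thesis by blast
qed

lemma finite_supp [simp]: "finite (supp t)"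
  using supp_rep finite_noms by metis

lemma finite_fv [simp]: "finite (fv t)"
proof -
  have "fv t \<subseteq> frees (rep_tm t)" using eqv_rep_tm by (auto simp: fv_def)
  then show ?thesis using finite_frees finite_subset by blast
qed

lemma supp_nom: "supp (tm_nom c) \<subseteq> {c}"
  using supp_subset_noms[of "Nom c"] by (simp add: tm_nom_def)

lemma supp_var [simp]: "supp (tm_var x) = {}"
  using supp_subset_noms[of "Free x"] by (simp add: tm_var_def)

lemma supp_app: "tm_ty t = Fun (tm_ty u) B \<Longrightarrow> supp (tm_app t u) \<subseteq> supp t \<union> supp u"
proof -
  assume ty: "tm_ty t = Fun (tm_ty u) B"
  obtain r where r: "tyof [] r = Some (tm_ty t)" "abs_tm r = t" "noms r = supp t" by (rule supp_rep)
  obtain v where v: "tyof [] v = Some (tm_ty u)" "abs_tm v = u" "noms v = supp u" by (rule supp_rep)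
  have "tm_app t u = abs_tm (App r v)" using tm_app_abs[of r _ B v] r v ty by simp
  then show ?thesis using supp_subset_noms[of "App r v" B] r v ty by simp
qed

text \<open>The second union runs over all variables because representatives without vacuous
  constants come with no control over their variables.\<close>

lemma supp_map:
  assumes "tm_typed f \<theta>"
  shows "supp (tm_map f \<theta> t) \<subseteq> (\<Union>c\<in>supp t. supp (f c)) \<union> (\<Union>x. supp (\<theta> x))"
proof -
  have "\<forall>t::'a tm. \<exists>r. tyof [] r = Some (tm_ty t) \<and> abs_tm r = t \<and> noms r = supp t"
    using supp_rep by metis
  then obtain R :: "'a tm \<Rightarrow> 'a raw" where R: "\<And>t. tyof [] (R t) = Some (tm_ty t)"
    "\<And>t. abs_tm (R t) = t" "\<And>t. noms (R t) = supp t"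
    by metis
  have "raw_typed (\<lambda>c. R (f c)) (\<lambda>x. R (\<theta> x))"
    using assms R(1) by (simp add: raw_typed_def tm_typed_def)
  from tm_map_abs[OF R(1) this, of t] tyof_raw_map[OF this R(1), of t]
  show ?thesis using supp_subset_noms R(2,3) by (fastforce simp: noms_raw_map)
qed

text \<open>With no single representative at hand that shows both the support and the free
  variables, \<open>f\<close> is exchanged on one representative and \<open>\<theta>\<close> on
  another, passing through the mixed pair.\<close>

lemma tm_map_cong:
  assumes "tm_typed f \<theta>" "tm_typed f' \<theta>'"
    and "\<And>c. c \<in> supp t \<Longrightarrow> f c = f' c" and "\<And>x. x \<in> fv t \<Longrightarrow> \<theta> x = \<theta>' x"
  shows "tm_map f \<theta> t = tm_map f' \<theta>' t"
proof -
  have ty: "tm_typed f' \<theta>" using assms(1,2) by (simp add: tm_typed_def)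
  obtain r where r: "tyof [] r = Some (tm_ty t)" "abs_tm r = t" "noms r = supp t" by (rule supp_rep)
  obtain q where q: "tyof [] q = Some (tm_ty t)" "abs_tm q = t" "frees q \<subseteq> fv t" by (rule fv_rep)
  have "tm_map f \<theta> t = tm_map f' \<theta> t"
    using tm_map_abs'[OF r(1) assms(1)] tm_map_abs'[OF r(1) ty] r assms(3)
      raw_map_cong[of r "\<lambda>c. rep_tm (f c)" "\<lambda>c. rep_tm (f' c)" "\<lambda>x. rep_tm (\<theta> x)" "\<lambda>x. rep_tm (\<theta> x)"]
    by simp
  also have "\<dots> = tm_map f' \<theta>' t"
    using tm_map_abs'[OF q(1) ty] tm_map_abs'[OF q(1) assms(2)] q assms(4)
      raw_map_cong[of q "\<lambda>c. rep_tm (f' c)" "\<lambda>c. rep_tm (f' c)" "\<lambda>x. rep_tm (\<theta> x)" "\<lambda>x. rep_tm (\<theta>' x)"]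
    by (simp add: subset_iff)
  finally show ?thesis .
qed

lemma tm_map_identify:
  assumes "finite {c. \<delta> c \<noteq> c}" "\<And>c. nty (\<delta> c) = nty c"
    and "\<And>c. \<delta> c \<noteq> c \<Longrightarrow> \<delta> c \<notin> supp (tm_map (\<lambda>c. tm_nom (\<delta> c)) tm_var t)"
  shows "tm_map (\<lambda>c. tm_nom (\<delta> c)) tm_var t = t"
proof -
  let ?t = "tm_map (\<lambda>c. tm_nom (\<delta> c)) tm_var t"
  have ty: "raw_typed (\<lambda>c. Nom (\<delta> c)) Free" by (simp add: raw_typed_def assms(2))
  \<comment> \<open>\<open>conv_identify\<close> inspects the constants of a raw right-hand side, so
    the image is taken in a representative without vacuous ones.\<close>
  obtain r where r: "tyof [] r = Some (tm_ty ?t)" "abs_tm r = ?t" "noms r = supp ?t" by (rule supp_rep)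
  have t: "?t = abs_tm (raw_perm \<delta> (rep_tm t))"
    using tm_map_abs[OF tyof_rep_tm[of t] ty]
    by (simp add: raw_perm_map tm_nom_def[abs_def] tm_var_def[abs_def])
  have "tyof [] (raw_perm \<delta> (rep_tm t)) = Some (tm_ty t)"
    using tyof_raw_map[OF ty tyof_rep_tm] by (simp add: raw_perm_map)
  then have "conv [] (tm_ty t) (raw_perm \<delta> (rep_tm t)) r"
    using abs_tm_eqD[OF _ _ r(1)] t r(2) by simp
  then have "conv [] (tm_ty t) (rep_tm t) r"
    using assms(3) r(3) by (intro conv_identify[OF assms(1) _ tyof_rep_tm]) auto
  then show ?thesis using r(2) abs_tm_eq by fastforce
qed


subsection \<open>Abstraction of nominal constants from terms\<close>

lemma lam_nom_abs:
  assumes "tyof [] r = Some A"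
  shows "lam_nom c (abs_tm r) = abs_tm (Lam (nty c) (raw_close 0 c r))"
    and "tyof [] (Lam (nty c) (raw_close 0 c r)) = Some (Fun (nty c) A)"
proof -
  have "conv [nty c] A (raw_close 0 c (rep_tm (abs_tm r))) (raw_close 0 c r)"
    using conv_raw_close[OF conv_rep_abs[OF assms], of "[]" "[]" c] by simp
  then show "lam_nom c (abs_tm r) = abs_tm (Lam (nty c) (raw_close 0 c r))"
    unfolding lam_nom_def by (rule abs_tm_eq[OF conv_Lam])
  show "tyof [] (Lam (nty c) (raw_close 0 c r)) = Some (Fun (nty c) A)"
    using tyof_raw_close[of "[]" "[]" r A c] assms by simp
qed

lemma tm_ty_lam_nom [simp]: "tm_ty (lam_nom c t) = Fun (nty c) (tm_ty t)"
  using tm_ty_abs[OF lam_nom_abs(2)[OF tyof_rep_tm[of t], of c]] lam_nom_abs(1)[OF tyof_rep_tm[of t], of c]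
  by simp

lemma supp_lam_nom: "supp (lam_nom c t) \<subseteq> supp t - {c}"
proof -
  obtain r where r: "tyof [] r = Some (tm_ty t)" "abs_tm r = t" "noms r = supp t" by (rule supp_rep)
  from supp_subset_noms[OF lam_nom_abs(2)[OF r(1), of c]] lam_nom_abs(1)[OF r(1), of c] r(2,3)
  show ?thesis by simp
qed

lemma app_lam_nom: "tm_app (lam_nom c t) (tm_nom c) = t"
proof -
  let ?r = "rep_tm t"
  have "lam_nom c t = abs_tm (Lam (nty c) (raw_close 0 c ?r))"
    using lam_nom_abs(1)[OF tyof_rep_tm[of t]] by simp
  then have "tm_app (lam_nom c t) (tm_nom c) = abs_tm (App (Lam (nty c) (raw_close 0 c ?r)) (Nom c))"
    using tm_app_abs[OF lam_nom_abs(2)[OF tyof_rep_tm[of t]], of "Nom c" c] by (simp add: tm_nom_def)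
  also have "\<dots> = abs_tm (inst 0 (Nom c) (raw_close 0 c ?r))"
    using lam_nom_abs(2)[OF tyof_rep_tm[of t], of c] by (intro abs_tm_eq conv_beta) auto
  also have "\<dots> = t" using inst_raw_close[OF tyof_rep_tm[of t]] by simp
  finally show ?thesis .
qed

text \<open>With \<open>app_lam_nom\<close> this makes \<open>lam_nom c t\<close> the only term of
  its type that avoids \<open>c\<close> and yields \<open>t\<close> on \<open>c\<close>. Commutation
  with permutations and substitutions is derived from that alone.\<close>

lemma lam_nom_app:
  assumes "c \<notin> supp t" "tm_ty t = Fun (nty c) B"
  shows "lam_nom c (tm_app t (tm_nom c)) = t"
proof -
  obtain r where r: "tyof [] r = Some (tm_ty t)" "abs_tm r = t" "noms r = supp t" by (rule supp_rep)
  have "tm_app t (tm_nom c) = abs_tm (App r (Nom c))"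
    using tm_app_abs[of r "nty c" B "Nom c"] r assms(2) by (simp add: tm_nom_def)
  then have "lam_nom c (tm_app t (tm_nom c)) = abs_tm (Lam (nty c) (App (lift 0 r) (Bnd 0)))"
    using lam_nom_abs(1)[of "App r (Nom c)" B c] r assms raw_close_fresh[of c r 0] by simp
  also have "\<dots> = abs_tm r" using r assms(2) by (intro abs_tm_eq[OF conv_eta[of _ _ _ B]]) simp
  finally show ?thesis using r(2) by simp
qed


subsection \<open>Permutations\<close>

lemma is_perm_id: "is_perm id"
  by (simp add: is_perm_def)

lemma is_perm_nty: "is_perm \<pi> \<Longrightarrow> nty (\<pi> c) = nty c"
  by (simp add: is_perm_def)

lemma is_perm_inj: "is_perm \<pi> \<Longrightarrow> inj_on \<pi> X"
  by (auto simp: is_perm_def intro: inj_on_subset[OF bij_is_inj])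

lemma is_perm_comp:
  assumes "is_perm \<pi>" "is_perm \<pi>'"
  shows "is_perm (\<lambda>c. \<pi> (\<pi>' c))"
proof -
  have "{c. \<pi> (\<pi>' c) \<noteq> c} \<subseteq> {c. \<pi>' c \<noteq> c} \<union> {c. \<pi> c \<noteq> c}" by auto
  moreover have "bij (\<lambda>c. \<pi> (\<pi>' c))"
    using assms bij_comp[of \<pi>' \<pi>] by (simp add: is_perm_def comp_def)
  ultimately show ?thesis
    using assms by (auto simp: is_perm_def intro: finite_subset)
qed

lemma is_perm_inv:
  assumes "is_perm \<pi>"
  shows "is_perm (inv \<pi>)" "inv \<pi> (\<pi> c) = c" "\<pi> (inv \<pi> c) = c"
proof -
  have b: "bij \<pi>" using assms by (simp add: is_perm_def)
  show i: "inv \<pi> (\<pi> c) = c" "\<pi> (inv \<pi> c) = c" for c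
    using b by (simp_all add: bij_is_inj bij_is_surj surj_f_inv_f)
  have "{c. inv \<pi> c \<noteq> c} = {c. \<pi> c \<noteq> c}" using i by metis
  moreover have "nty (inv \<pi> c) = nty c" for c using is_perm_nty[OF assms, of "inv \<pi> c"] i by simp
  ultimately show "is_perm (inv \<pi>)" using assms b by (simp add: is_perm_def bij_imp_bij_inv)
qed

lemma is_perm_swap: "nty a = nty b \<Longrightarrow> is_perm (id(a := b, b := a))"
proof -
  assume "nty a = nty b"
  moreover have "bij (id(a := b, b := a))"
    by (rule o_bij[of "id(a := b, b := a)"]) auto
  moreover have "{c. (id(a := b, b := a)) c \<noteq> c} \<subseteq> {a, b}" by auto
  then have "finite {c. (id(a := b, b := a)) c \<noteq> c}" by (rule finite_subset) simp
  ultimately show ?thesis by (simp add: is_perm_def)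
qed

text \<open>Composing with one swap corrects the value at the new point; injectivity keeps the
  values already reached clear of both swapped constants.\<close>

lemma perm_extend:
  assumes "finite X" "inj_on f X" "\<And>c. c \<in> X \<Longrightarrow> nty (f c) = nty c"
  shows "\<exists>\<pi>. is_perm \<pi> \<and> (\<forall>c\<in>X. \<pi> c = f c)"
  using assms
proof (induction X)
  case empty
  then show ?case using is_perm_id by blast
next
  case (insert a X)
  then obtain \<pi> where \<pi>: "is_perm \<pi>" "\<forall>c\<in>X. \<pi> c = f c" by auto
  let ?\<sigma> = "id(\<pi> a := f a, f a := \<pi> a)"
  have "?\<sigma> (\<pi> c) = f c" if "c \<in> X" for c
  proof -
    have "c \<noteq> a" using that insert.hyps by blast
    then have "f c \<noteq> f a" using insert.prems(1) that by (auto simp: inj_on_def)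
    moreover have "\<pi> c \<noteq> \<pi> a"
      using is_perm_inj[OF \<pi>(1), of UNIV] \<open>c \<noteq> a\<close> by (auto simp: inj_on_def)
    ultimately show ?thesis using \<pi>(2) that by auto
  qed
  moreover have "?\<sigma> (\<pi> a) = f a" by simp
  moreover have "is_perm (\<lambda>c. ?\<sigma> (\<pi> c))"
    using insert.prems(2)[of a] is_perm_nty[OF \<pi>(1)] by (intro is_perm_comp[OF is_perm_swap \<pi>(1)]) simp
  ultimately show ?case by blast
qed

lemma fresh_names:
  assumes "finite Y"
  obtains f :: "nom \<Rightarrow> nom" where "inj f" "\<And>c. nty (f c) = nty c" "range f \<inter> Y = {}"
proof -
  define idx where "idx c = (case c of N n A \<Rightarrow> n)" for c
  \<comment> \<open>Shifting every index past those in \<open>Y\<close> renames all constants at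
    once, injectively and without changing types; the inserted 0 covers an empty
    \<open>Y\<close>.\<close>
  define m where "m = Suc (Max (insert 0 (idx ` Y)))"
  define f where "f c = (case c of N n A \<Rightarrow> N (n + m) A)" for c
  have "idx c < m" if "c \<in> Y" for c using that assms by (simp add: m_def less_Suc_eq_le)
  moreover have "m \<le> idx (f c)" for c by (simp add: f_def idx_def split: nom.split)
  ultimately have "range f \<inter> Y = {}" by (auto simp: disjoint_iff) (metis leD)
  moreover have "inj f" by (rule injI) (auto simp: f_def split: nom.splits)
  moreover have "nty (f c) = nty c" for c by (simp add: f_def split: nom.split)
  ultimately show ?thesis using that by blast
qed

lemma fresh_vars:
  assumes "finite Y"
  obtains z :: "nom \<Rightarrow> var" where "inj z" "\<And>c. vty (z c) = nty c" "range z \<inter> Y = {}"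
proof -
  define idx where "idx x = (case x of V n A \<Rightarrow> n)" for x
  define m where "m = Suc (Max (insert 0 (idx ` Y)))"
  define z where "z c = (case c of N n A \<Rightarrow> V (n + m) A)" for c
  have "idx x < m" if "x \<in> Y" for x using that assms by (simp add: m_def less_Suc_eq_le)
  moreover have "m \<le> idx (z c)" for c by (simp add: z_def idx_def split: nom.split)
  ultimately have "range z \<inter> Y = {}" by (auto simp: disjoint_iff) (metis leD)
  moreover have "inj z" by (rule injI) (auto simp: z_def split: nom.splits)
  moreover have "vty (z c) = nty c" for c by (simp add: z_def split: nom.split)
  ultimately show ?thesis using that by blast
qed

lemma perm_avoid:
  assumes "finite X" "finite K" "finite Y"
  obtains \<pi> where "is_perm \<pi>" "\<And>c. c \<in> K \<Longrightarrow> \<pi> c = c" "\<pi> ` (X - K) \<inter> Y = {}"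
proof -
  obtain f where f: "inj f" "\<And>c. nty (f c) = nty c" "range f \<inter> (Y \<union> K) = {}"
    using fresh_names[of "Y \<union> K"] assms by blast
  let ?g = "\<lambda>c. if c \<in> K then c else f c"
  have "f c \<notin> Y \<union> K" for c using f(3) by blast
  note fr = this
  have "inj_on ?g (X \<union> K)" using f(1) fr by (auto simp: inj_on_def)
  then have "\<exists>\<pi>. is_perm \<pi> \<and> (\<forall>c \<in> X \<union> K. \<pi> c = ?g c)"
    using assms f(2) by (intro perm_extend) auto
  then obtain \<pi> where \<pi>: "is_perm \<pi>" "\<forall>c \<in> X \<union> K. \<pi> c = ?g c" by blast
  have "\<pi> c = f c" if "c \<in> X - K" for c using that \<pi>(2) by simp
  then have "\<pi> ` (X - K) \<inter> Y = {}" using fr by force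
  moreover have "\<pi> c = c" if "c \<in> K" for c using that \<pi>(2) by simp
  ultimately show ?thesis using that \<pi>(1) by blast
qed

lemma perm_fresh:
  assumes "finite X" "finite Y"
  obtains \<pi> where "is_perm \<pi>" "\<pi> ` X \<inter> Y = {}"
proof -
  obtain \<pi> where "is_perm \<pi>" "\<pi> ` (X - {}) \<inter> Y = {}"
    using perm_avoid[OF assms(1) finite.emptyI assms(2)] by metis
  then show ?thesis using that by simp
qed

text \<open>The reason why the permutations picked by \<open>SOME\<close> do not matter: two ways of
  moving \<open>X\<close> off \<open>Y\<close> differ by a renaming that leaves \<open>Y\<close>
  alone. Off \<open>Y\<close> it is the second after the inverse of the first, and it is injective
  as both images avoid \<open>Y\<close>.\<close>

lemma perm_transfer:
  assumes "is_perm \<pi>" "is_perm \<pi>'" "finite X" "finite Y" "\<pi> ` X \<inter> Y = {}" "\<pi>' ` X \<inter> Y = {}"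
  obtains \<mu> where "is_perm \<mu>" "\<And>c. c \<in> X \<Longrightarrow> \<mu> (\<pi> c) = \<pi>' c" "\<And>c. c \<in> Y \<Longrightarrow> \<mu> c = c"
proof -
  define f where "f c = (if c \<in> Y then c else \<pi>' (inv \<pi> c))" for c
  have fX: "f (\<pi> c) = \<pi>' c" if "c \<in> X" for c
  proof -
    have "\<pi> c \<notin> Y" using assms(5) that by blast
    then show ?thesis by (simp add: f_def is_perm_inv(2)[OF assms(1)])
  qed
  have fY: "f c = c" if "c \<in> Y" for c using that by (simp add: f_def)
  have "inj_on f (\<pi> ` X)"
  proof (rule inj_onI, safe)
    fix a b assume "a \<in> X" "b \<in> X" "f (\<pi> a) = f (\<pi> b)"
    then have "\<pi>' a = \<pi>' b" by (simp add: fX)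
    then show "\<pi> a = \<pi> b" using is_perm_inj[OF assms(2), of UNIV] by (simp add: inj_eq)
  qed
  moreover have "inj_on f Y" using fY by (simp add: inj_on_def)
  moreover have "f ` (\<pi> ` X) = \<pi>' ` X" "f ` Y = Y"
    using fX fY by (simp_all add: image_image)
  then have "f ` (\<pi> ` X - Y) \<inter> f ` (Y - \<pi> ` X) = {}" using assms(6) by blast
  ultimately have "inj_on f (\<pi> ` X \<union> Y)" by (simp add: inj_on_Un)
  moreover have "nty (f c) = nty c" for c
    using is_perm_nty[OF assms(2)] is_perm_nty[OF is_perm_inv(1)[OF assms(1)]] by (simp add: f_def)
  ultimately have "\<exists>\<mu>. is_perm \<mu> \<and> (\<forall>c \<in> \<pi> ` X \<union> Y. \<mu> c = f c)"
    using assms(3,4) by (intro perm_extend) simp_all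
  then obtain \<mu> where \<mu>: "is_perm \<mu>" "\<forall>c \<in> \<pi> ` X \<union> Y. \<mu> c = f c" by blast
  show ?thesis
    by (rule that[OF \<mu>(1)]) (simp_all add: \<mu>(2) fX fY)
qed


subsection \<open>Permuting and substituting in terms\<close>

lemma is_subst_ty: "is_subst \<theta> \<Longrightarrow> tm_ty (\<theta> x) = vty x"
  by (simp add: is_subst_def)

lemma tm_typed_perm: "(\<And>c. nty (\<delta> c) = nty c) \<Longrightarrow> tm_typed (\<lambda>c. tm_nom (\<delta> c)) tm_var"
  by (simp add: tm_typed_def)

lemma tm_typed_subst: "is_subst \<theta> \<Longrightarrow> tm_typed tm_nom \<theta>"
  by (simp add: tm_typed_def is_subst_def)

lemma tm_perm_map:
  assumes "\<And>c. nty (\<delta> c) = nty c"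
  shows "tm_perm \<delta> t = tm_map (\<lambda>c. tm_nom (\<delta> c)) tm_var t"
proof -
  have "raw_typed (\<lambda>c. Nom (\<delta> c)) Free" by (simp add: raw_typed_def assms)
  from tm_map_abs[OF tyof_rep_tm[of t] this] show ?thesis
    by (simp add: tm_perm_def raw_perm_map tm_nom_def[abs_def] tm_var_def[abs_def])
qed

lemma tm_subst_map:
  assumes "is_subst \<theta>"
  shows "tm_subst t \<theta> = tm_map tm_nom \<theta> t"
proof -
  have "raw_typed Nom (\<lambda>x. rep_tm (\<theta> x))"
    by (simp add: raw_typed_def is_subst_ty[OF assms] tyof_rep_tm)
  from tm_map_abs[OF tyof_rep_tm[of t] this] show ?thesis
    by (simp add: tm_subst_def raw_subst_map tm_nom_def[abs_def])
qed

lemma is_perm_map: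
  assumes "is_perm \<pi>"
  shows "tm_perm \<pi> t = tm_map (\<lambda>c. tm_nom (\<pi> c)) tm_var t"
    and "tm_typed (\<lambda>c. tm_nom (\<pi> c)) tm_var"
  using tm_perm_map tm_typed_perm is_perm_nty[OF assms] by blast+

lemma tm_ty_perm [simp]: "is_perm \<pi> \<Longrightarrow> tm_ty (tm_perm \<pi> t) = tm_ty t"
  by (simp add: is_perm_map tm_ty_map)

lemma tm_ty_subst: "is_subst \<theta> \<Longrightarrow> tm_ty (tm_subst t \<theta>) = tm_ty t"
  by (simp add: tm_subst_map tm_typed_subst tm_ty_map)

lemma tm_perm_var [simp]: "is_perm \<pi> \<Longrightarrow> tm_perm \<pi> (tm_var x) = tm_var x"
  by (simp add: is_perm_map)

lemma tm_perm_nom [simp]: "is_perm \<pi> \<Longrightarrow> tm_perm \<pi> (tm_nom c) = tm_nom (\<pi> c)"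
  by (simp add: is_perm_map)

lemma tm_subst_var [simp]: "is_subst \<theta> \<Longrightarrow> tm_subst (tm_var x) \<theta> = \<theta> x"
  by (simp add: tm_subst_map tm_typed_subst)

lemma tm_subst_nom [simp]: "is_subst \<theta> \<Longrightarrow> tm_subst (tm_nom c) \<theta> = tm_nom c"
  by (simp add: tm_subst_map tm_typed_subst)

lemma tm_perm_app:
  "is_perm \<pi> \<Longrightarrow> tm_ty t = Fun (tm_ty u) B \<Longrightarrow>
   tm_perm \<pi> (tm_app t u) = tm_app (tm_perm \<pi> t) (tm_perm \<pi> u)"
  by (simp add: is_perm_map tm_map_app)

lemma tm_subst_app:
  "is_subst \<theta> \<Longrightarrow> tm_ty t = Fun (tm_ty u) B \<Longrightarrow>
   tm_subst (tm_app t u) \<theta> = tm_app (tm_subst t \<theta>) (tm_subst u \<theta>)"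
  by (simp add: tm_subst_map tm_typed_subst tm_map_app)

lemma tm_perm_perm:
  assumes "is_perm \<pi>" "is_perm \<pi>'"
  shows "tm_perm \<pi> (tm_perm \<pi>' t) = tm_perm (\<lambda>c. \<pi> (\<pi>' c)) t"
  by (simp add: is_perm_map assms is_perm_comp tm_map_map)

lemma tm_perm_cong:
  assumes "is_perm \<pi>" "is_perm \<pi>'" "\<And>c. c \<in> supp t \<Longrightarrow> \<pi> c = \<pi>' c"
  shows "tm_perm \<pi> t = tm_perm \<pi>' t"
  unfolding is_perm_map(1)[OF assms(1)] is_perm_map(1)[OF assms(2)]
  by (rule tm_map_cong) (use assms in \<open>auto simp: is_perm_map\<close>)

lemma tm_perm_id [simp]: "tm_perm id t = t"
  by (simp add: is_perm_map(1)[OF is_perm_id])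

lemma tm_perm_ident:
  assumes "is_perm \<pi>" "\<And>c. c \<in> supp t \<Longrightarrow> \<pi> c = c"
  shows "tm_perm \<pi> t = t"
  using tm_perm_cong[OF assms(1) is_perm_id, of t] assms(2) by simp

lemma tm_perm_inv:
  assumes "is_perm \<pi>"
  shows "tm_perm (inv \<pi>) (tm_perm \<pi> t) = t"
  using is_perm_inv[OF assms] tm_perm_perm[OF is_perm_inv(1)[OF assms] assms, of t] tm_perm_id[of t]
  by (simp add: id_def)

lemma supp_perm:
  assumes "is_perm \<pi>"
  shows "supp (tm_perm \<pi> t) = \<pi> ` supp t"
proof
  have *: "supp (tm_perm \<pi> t) \<subseteq> \<pi> ` supp t" if "is_perm \<pi>" for \<pi> and t :: "'a tm"
    using supp_map[OF is_perm_map(2)[OF that], of t] supp_nom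
    by (fastforce simp: is_perm_map(1)[OF that])
  show "supp (tm_perm \<pi> t) \<subseteq> \<pi> ` supp t" by (rule *[OF assms])
  have "supp t \<subseteq> inv \<pi> ` supp (tm_perm \<pi> t)"
    using *[OF is_perm_inv(1)[OF assms], of "tm_perm \<pi> t"] tm_perm_inv[OF assms, of t] by simp
  then show "\<pi> ` supp t \<subseteq> supp (tm_perm \<pi> t)" using is_perm_inv[OF assms] by force
qed

lemma supp_tm_subst: "is_subst \<theta> \<Longrightarrow> supp (tm_subst t \<theta>) \<subseteq> supp t \<union> supp_subst \<theta>"
  using supp_map[OF tm_typed_subst, of \<theta> t] supp_nom
  by (fastforce simp: tm_subst_map supp_subst_def)

lemma supp_subst_mem: "c \<in> supp (\<theta> x) \<Longrightarrow> c \<in> supp_subst \<theta>"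
  by (auto simp: supp_subst_def)

lemma finite_supp_subst:
  assumes "is_subst \<theta>"
  shows "finite (supp_subst \<theta>)"
proof -
  have "supp_subst \<theta> \<subseteq> (\<Union>x\<in>{x. \<theta> x \<noteq> tm_var x}. supp (\<theta> x))"
  proof
    fix c assume "c \<in> supp_subst \<theta>"
    then obtain x where x: "c \<in> supp (\<theta> x)" by (auto simp: supp_subst_def)
    then have "\<theta> x \<noteq> tm_var x" by (metis empty_iff supp_var)
    with x show "c \<in> (\<Union>x\<in>{x. \<theta> x \<noteq> tm_var x}. supp (\<theta> x))" by blast
  qed
  then show ?thesis
    by (rule finite_subset) (use assms in \<open>auto simp: is_subst_def\<close>)
qed

lemma is_subst_finite:
  assumes "\<And>x. tm_ty (\<theta> x) = vty x" "finite X" "\<And>x. x \<notin> X \<Longrightarrow> \<theta> x = tm_var x"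
  shows "is_subst \<theta>"
proof -
  have "{x. \<theta> x \<noteq> tm_var x} \<subseteq> X" using assms(3) by auto
  then have "finite {x. \<theta> x \<noteq> tm_var x}" using assms(2) by (rule finite_subset)
  then show ?thesis using assms(1) by (simp add: is_subst_def)
qed

lemma is_subst_perm:
  assumes "is_perm \<pi>" "is_subst \<theta>"
  shows "is_subst (perm_subst \<pi> \<theta>)"
  by (rule is_subst_finite[of _ "{x. \<theta> x \<noteq> tm_var x}"])
    (use assms in \<open>auto simp: perm_subst_def is_subst_def\<close>)

lemma is_subst_comp:
  assumes "is_subst \<theta>" "is_subst \<rho>"
  shows "is_subst (comp_subst \<theta> \<rho>)"
proof (rule is_subst_finite[of _ "{x. \<theta> x \<noteq> tm_var x} \<union> {x. \<rho> x \<noteq> tm_var x}"])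
  show "tm_ty (comp_subst \<theta> \<rho> x) = vty x" for x
    using assms by (simp add: comp_subst_def tm_ty_subst is_subst_ty)
  show "finite ({x. \<theta> x \<noteq> tm_var x} \<union> {x. \<rho> x \<noteq> tm_var x})"
    using assms by (simp add: is_subst_def)
qed (use assms in \<open>simp add: comp_subst_def\<close>)

lemma is_subst_restr:
  assumes "is_subst \<theta>"
  shows "is_subst (restr \<Sigma> \<theta>)"
  by (rule is_subst_finite[of _ "{x. \<theta> x \<noteq> tm_var x}"])
    (use assms in \<open>auto simp: restr_def is_subst_def\<close>)

lemma tm_perm_subst:
  assumes "is_perm \<pi>" "is_subst \<theta>"
  shows "tm_perm \<pi> (tm_subst t \<theta>) = tm_subst (tm_perm \<pi> t) (perm_subst \<pi> \<theta>)"
  using assms is_subst_perm[OF assms]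
  by (simp add: is_perm_map tm_subst_map tm_map_map tm_typed_subst perm_subst_def)

lemma tm_subst_subst:
  assumes "is_subst \<theta>" "is_subst \<rho>"
  shows "tm_subst (tm_subst t \<theta>) \<rho> = tm_subst t (comp_subst \<theta> \<rho>)"
  using assms is_subst_comp[OF assms]
  by (simp add: tm_subst_map tm_map_map tm_typed_subst comp_subst_def)

lemma tm_subst_cong:
  assumes "is_subst \<theta>" "is_subst \<theta>'" "\<And>x. x \<in> fv t \<Longrightarrow> \<theta> x = \<theta>' x"
  shows "tm_subst t \<theta> = tm_subst t \<theta>'"
  using assms by (simp add: tm_subst_map) (rule tm_map_cong, auto intro: tm_typed_subst)

lemma perm_subst_perm:
  "is_perm \<pi> \<Longrightarrow> is_perm \<pi>' \<Longrightarrow> perm_subst \<pi> (perm_subst \<pi>' \<theta>) = perm_subst (\<lambda>c. \<pi> (\<pi>' c)) \<theta>"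
  by (simp add: perm_subst_def tm_perm_perm)

lemma perm_subst_inv: "is_perm \<pi> \<Longrightarrow> perm_subst (inv \<pi>) (perm_subst \<pi> \<theta>) = \<theta>"
  by (simp add: perm_subst_def tm_perm_inv)

lemma perm_subst_ident:
  "is_perm \<pi> \<Longrightarrow> (\<And>c. c \<in> supp_subst \<theta> \<Longrightarrow> \<pi> c = c) \<Longrightarrow> perm_subst \<pi> \<theta> = \<theta>"
  by (auto simp: perm_subst_def supp_subst_def intro!: tm_perm_ident)

lemma perm_subst_cong:
  "is_perm \<pi> \<Longrightarrow> is_perm \<pi>' \<Longrightarrow> (\<And>c. c \<in> supp_subst \<theta> \<Longrightarrow> \<pi> c = \<pi>' c) \<Longrightarrow>
   perm_subst \<pi> \<theta> = perm_subst \<pi>' \<theta>"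
  by (auto simp: perm_subst_def supp_subst_def intro!: tm_perm_cong)

lemma supp_perm_subst: "is_perm \<pi> \<Longrightarrow> supp_subst (perm_subst \<pi> \<theta>) = \<pi> ` supp_subst \<theta>"
  by (simp add: supp_subst_def perm_subst_def supp_perm image_UN)

lemma perm_comp_subst:
  "is_perm \<pi> \<Longrightarrow> is_subst \<rho> \<Longrightarrow>
   perm_subst \<pi> (comp_subst \<theta> \<rho>) = comp_subst (perm_subst \<pi> \<theta>) (perm_subst \<pi> \<rho>)"
  by (simp add: comp_subst_def tm_perm_subst) (simp add: perm_subst_def comp_subst_def tm_perm_subst)

lemma supp_comp_subst:
  "is_subst \<rho> \<Longrightarrow> supp_subst (comp_subst \<theta> \<rho>) \<subseteq> supp_subst \<theta> \<union> supp_subst \<rho>"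
  using supp_tm_subst unfolding comp_subst_def supp_subst_def by fastforce

lemma restr_perm_subst: "is_perm \<pi> \<Longrightarrow> restr \<Sigma> (perm_subst \<pi> \<theta>) = perm_subst \<pi> (restr \<Sigma> \<theta>)"
  by (auto simp: restr_def perm_subst_def)

lemma perm_lam_nom:
  assumes "is_perm \<pi>"
  shows "tm_perm \<pi> (lam_nom c t) = lam_nom (\<pi> c) (tm_perm \<pi> t)"
proof -
  let ?L = "tm_perm \<pi> (lam_nom c t)"
  have "\<pi> c \<notin> supp ?L"
    using supp_lam_nom[of c t] is_perm_inj[OF assms, of UNIV]
    by (auto simp: supp_perm[OF assms] inj_on_def)
  then have "lam_nom (\<pi> c) (tm_app ?L (tm_nom (\<pi> c))) = ?L"
    by (rule lam_nom_app) (simp add: assms is_perm_nty)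
  moreover have "tm_app ?L (tm_nom (\<pi> c)) = tm_perm \<pi> t"
    using tm_perm_app[OF assms, of "lam_nom c t" "tm_nom c" "tm_ty t"] app_lam_nom[of c t]
    by (simp add: assms)
  ultimately show ?thesis by simp
qed

lemma subst_lam_nom:
  assumes "is_subst \<theta>" "c \<notin> supp_subst \<theta>"
  shows "tm_subst (lam_nom c t) \<theta> = lam_nom c (tm_subst t \<theta>)"
proof -
  let ?L = "tm_subst (lam_nom c t) \<theta>"
  have "c \<notin> supp ?L" using supp_lam_nom[of c t] supp_tm_subst[OF assms(1)] assms(2) by blast
  then have "lam_nom c (tm_app ?L (tm_nom c)) = ?L"
    by (rule lam_nom_app) (simp add: tm_ty_subst assms(1))
  moreover have "tm_app ?L (tm_nom c) = tm_subst t \<theta>"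
    using tm_subst_app[OF assms(1), of "lam_nom c t" "tm_nom c" "tm_ty t"] app_lam_nom[of c t]
    by (simp add: assms(1))
  ultimately show ?thesis by simp
qed

lemma perm_lam_noms: "is_perm \<pi> \<Longrightarrow> tm_perm \<pi> (lam_noms cs t) = lam_noms (map \<pi> cs) (tm_perm \<pi> t)"
  by (induction cs) (auto simp: perm_lam_nom)

lemma subst_lam_noms:
  "is_subst \<theta> \<Longrightarrow> set cs \<inter> supp_subst \<theta> = {} \<Longrightarrow>
   tm_subst (lam_noms cs t) \<theta> = lam_noms cs (tm_subst t \<theta>)"
  by (induction cs) (auto simp: subst_lam_nom)

lemma lam_noms_inj: "lam_noms cs t = lam_noms cs u \<Longrightarrow> t = u"
  by (induction cs) (auto, metis app_lam_nom)

lemma supp_lam_noms: "supp (lam_noms cs t) \<subseteq> supp t - set cs"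
  by (induction cs) (auto dest: subsetD[OF supp_lam_nom])

lemma tm_ty_lam_noms [simp]: "tm_ty (lam_noms cs t) = Funs (map nty cs) (tm_ty t)"
  by (induction cs) auto

section \<open>Iterated application to nominal constants\<close>

definition tm_apps :: "'k::signature tm \<Rightarrow> nom list \<Rightarrow> 'k tm" where
  "tm_apps t cs = foldl tm_app t (map tm_nom cs)"

lemma tm_apps_simps [simp]:
  "tm_apps t [] = t" "tm_apps t (c # cs) = tm_apps (tm_app t (tm_nom c)) cs"
  by (simp_all add: tm_apps_def)

lemma tm_apps_abs:
  "tyof [] r = Some (Funs (map nty cs) B) \<Longrightarrow>
   abs_tm (foldl App r (map Nom cs)) = tm_apps (abs_tm r) cs"
proof (induction cs arbitrary: r)
  case (Cons c cs)
  then show ?case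
    using tm_app_abs[of r "nty c" "Funs (map nty cs) B" "Nom c"] Cons.IH[of "App r (Nom c)"]
    by (simp add: tm_nom_def)
qed simp

lemma tm_ty_apps: "tm_ty t = Funs (map nty cs) B \<Longrightarrow> tm_ty (tm_apps t cs) = B"
  by (induction cs arbitrary: t) (auto simp: tm_ty_app)

lemma supp_apps: "tm_ty t = Funs (map nty cs) B \<Longrightarrow> supp (tm_apps t cs) \<subseteq> supp t \<union> set cs"
proof (induction cs arbitrary: t)
  case (Cons c cs)
  have "supp (tm_app t (tm_nom c)) \<subseteq> supp t \<union> {c}"
    using supp_app[of t "tm_nom c"] supp_nom[of c] Cons.prems by fastforce
  with Cons.IH[of "tm_app t (tm_nom c)"] Cons.prems show ?case by (fastforce simp: tm_ty_app)
qed simp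

lemma perm_apps:
  "is_perm \<pi> \<Longrightarrow> tm_ty t = Funs (map nty cs) B \<Longrightarrow>
   tm_perm \<pi> (tm_apps t cs) = tm_apps (tm_perm \<pi> t) (map \<pi> cs)"
proof (induction cs arbitrary: t)
  case (Cons c cs)
  then show ?case
    using tm_perm_app[of \<pi> t "tm_nom c" "Funs (map nty cs) B"] by (simp add: tm_ty_app)
qed simp

lemma subst_apps:
  "is_subst \<theta> \<Longrightarrow> tm_ty t = Funs (map nty cs) B \<Longrightarrow>
   tm_subst (tm_apps t cs) \<theta> = tm_apps (tm_subst t \<theta>) cs"
proof (induction cs arbitrary: t)
  case (Cons c cs)
  then show ?case
    using tm_subst_app[of \<theta> t "tm_nom c" "Funs (map nty cs) B"] by (simp add: tm_ty_app)
qed simp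

lemma apps_lam_noms: "tm_apps (lam_noms cs t) cs = t"
  by (induction cs) (auto simp: app_lam_nom)


subsection \<open>Independence of the choice of permutations\<close>

lemma nom_comp_choice:
  assumes "is_subst \<theta>" "is_subst \<rho>"
  obtains \<pi> where "is_perm \<pi>" "supp_subst (perm_subst \<pi> \<theta>) \<inter> supp_subst \<rho> = {}"
    "nom_comp \<theta> \<rho> = comp_subst (perm_subst \<pi> \<theta>) \<rho>"
proof -
  let ?P = "\<lambda>\<pi>. is_perm \<pi> \<and> supp_subst (perm_subst \<pi> \<theta>) \<inter> supp_subst \<rho> = {}"
  obtain \<pi> where "is_perm \<pi>" "\<pi> ` supp_subst \<theta> \<inter> supp_subst \<rho> = {}"
    by (rule perm_fresh[OF finite_supp_subst[OF assms(1)] finite_supp_subst[OF assms(2)]])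
  then have "?P \<pi>" by (simp add: supp_perm_subst)
  then have "?P (SOME \<pi>. ?P \<pi>)" by (rule someI[of ?P])
  then show ?thesis using that[of "SOME \<pi>. ?P \<pi>"] by (simp add: nom_comp_def Let_def)
qed

lemma is_subst_nom_comp:
  assumes "is_subst \<theta>" "is_subst \<rho>"
  shows "is_subst (nom_comp \<theta> \<rho>)"
  using nom_comp_choice[OF assms] assms is_subst_comp is_subst_perm by metis

lemma nom_comp_equiv:
  assumes "is_subst \<theta>" "is_subst \<rho>" "is_perm \<pi>"
    and "supp_subst (perm_subst \<pi> \<theta>) \<inter> supp_subst \<rho> = {}"
  obtains \<mu> where "is_perm \<mu>" "comp_subst (perm_subst \<pi> \<theta>) \<rho> = perm_subst \<mu> (nom_comp \<theta> \<rho>)"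
proof -
  obtain \<pi>' where \<pi>': "is_perm \<pi>'" "supp_subst (perm_subst \<pi>' \<theta>) \<inter> supp_subst \<rho> = {}"
    "nom_comp \<theta> \<rho> = comp_subst (perm_subst \<pi>' \<theta>) \<rho>"
    using nom_comp_choice[OF assms(1,2)] .
  obtain \<mu> where \<mu>: "is_perm \<mu>" "\<And>c. c \<in> supp_subst \<theta> \<Longrightarrow> \<mu> (\<pi>' c) = \<pi> c"
    "\<And>c. c \<in> supp_subst \<rho> \<Longrightarrow> \<mu> c = c"
    using perm_transfer[OF \<pi>'(1) assms(3) finite_supp_subst[OF assms(1)] finite_supp_subst[OF assms(2)]]
      \<pi>'(2) assms(4) by (auto simp: supp_perm_subst \<pi>'(1) assms(3))
  have "perm_subst \<mu> (nom_comp \<theta> \<rho>) = comp_subst (perm_subst \<mu> (perm_subst \<pi>' \<theta>)) (perm_subst \<mu> \<rho>)"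
    by (simp add: \<pi>'(3) perm_comp_subst \<mu>(1) assms(2))
  also have "perm_subst \<mu> \<rho> = \<rho>" by (rule perm_subst_ident[OF \<mu>(1,3)])
  also have "perm_subst \<mu> (perm_subst \<pi>' \<theta>) = perm_subst \<pi> \<theta>"
    unfolding perm_subst_perm[OF \<mu>(1) \<pi>'(1)]
    by (rule perm_subst_cong[OF is_perm_comp[OF \<mu>(1) \<pi>'(1)] assms(3) \<mu>(2)])
  finally show ?thesis using that \<mu>(1) by simp
qed

section \<open>Nominal substitution in formulas\<close>

lemma finite_supp_form [simp]: "finite (supp_form B)"
  by (cases B) simp

lemma perm_form_perm:
  "is_perm \<pi> \<Longrightarrow> is_perm \<pi>' \<Longrightarrow> perm_form \<pi> (perm_form \<pi>' B) = perm_form (\<lambda>c. \<pi> (\<pi>' c)) B"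
  by (cases B) (simp add: tm_perm_perm)

lemma perm_form_cong:
  "is_perm \<pi> \<Longrightarrow> is_perm \<pi>' \<Longrightarrow> (\<And>c. c \<in> supp_form B \<Longrightarrow> \<pi> c = \<pi>' c) \<Longrightarrow> perm_form \<pi> B = perm_form \<pi>' B"
  by (cases B) (auto intro: tm_perm_cong)

lemma perm_subst_form:
  "is_perm \<pi> \<Longrightarrow> is_subst \<theta> \<Longrightarrow>
   perm_form \<pi> (subst_form B \<theta>) = subst_form (perm_form \<pi> B) (perm_subst \<pi> \<theta>)"
  by (cases B) (simp add: tm_perm_subst)

lemma holds_perm_form:
  assumes "is_perm \<pi>" "holds B"
  shows "holds (perm_form \<pi> B)"
proof (cases B)
  case (NAbs n s t)
  with assms(2) obtain cs where "length cs = n" "distinct cs" "s = lam_noms cs t" by auto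
  then have "length (map \<pi> cs) = n" "distinct (map \<pi> cs)"
    "tm_perm \<pi> s = lam_noms (map \<pi> cs) (tm_perm \<pi> t)"
    using perm_lam_noms[OF assms(1)] is_perm_inj[OF assms(1)] by (auto simp: distinct_map)
  then show ?thesis unfolding NAbs perm_form.simps holds.simps by blast
qed

lemma holds_nom_subst_form:
  assumes "is_subst \<theta>" "is_perm \<pi>" "\<pi> ` supp_form B \<inter> supp_subst \<theta> = {}"
  shows "holds (nom_subst_form B \<theta>) \<longleftrightarrow> holds (subst_form (perm_form \<pi> B) \<theta>)"
proof -
  let ?P = "\<lambda>\<pi>. is_perm \<pi> \<and> \<pi> ` supp_form B \<inter> supp_subst \<theta> = {}"
  have *: "holds (subst_form (perm_form \<pi>' B) \<theta>)"
    if p: "?P \<pi>" "?P \<pi>'" and h: "holds (subst_form (perm_form \<pi> B) \<theta>)" for \<pi> \<pi>'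
  proof -
    obtain \<mu> where \<mu>: "is_perm \<mu>" "\<And>c. c \<in> supp_form B \<Longrightarrow> \<mu> (\<pi> c) = \<pi>' c"
      "\<And>c. c \<in> supp_subst \<theta> \<Longrightarrow> \<mu> c = c"
      using perm_transfer[of \<pi> \<pi>' "supp_form B" "supp_subst \<theta>"] p finite_supp_subst[OF assms(1)]
      by auto
    have "perm_form \<mu> (perm_form \<pi> B) = perm_form \<pi>' B"
      using p \<mu> by (simp add: perm_form_perm) (rule perm_form_cong, auto intro: is_perm_comp)
    moreover have "perm_subst \<mu> \<theta> = \<theta>" by (rule perm_subst_ident[OF \<mu>(1,3)])
    ultimately show ?thesis
      using holds_perm_form[OF \<mu>(1) h] perm_subst_form[OF \<mu>(1) assms(1)] by simp
  qed
  have P: "?P \<pi>" using assms by simp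
  then have "?P (SOME \<pi>. ?P \<pi>)" by (rule someI[of ?P])
  with P show ?thesis unfolding nom_subst_form_def Let_def using * by blast
qed

text \<open>Both halves rely on this to pass to a conveniently renamed substitution. If \<pi> is
  admissible for \<theta>, then \<pi> followed by \<mu> is admissible for the renamed \<theta>, and
  truth is preserved under permutations.\<close>

lemma na_solution_perm:
  assumes "na_solution B \<theta>" "is_perm \<mu>"
  shows "na_solution B (perm_subst \<mu> \<theta>)"
proof -
  have \<theta>: "is_subst \<theta>" using assms(1) by (simp add: na_solution_def)
  obtain \<pi> where \<pi>: "is_perm \<pi>" "\<pi> ` supp_form B \<inter> supp_subst \<theta> = {}"
    by (rule perm_fresh[OF finite_supp_form finite_supp_subst[OF \<theta>]])
  have "holds (subst_form (perm_form \<pi> B) \<theta>)"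
    using assms(1) holds_nom_subst_form[OF \<theta> \<pi>(1)] \<pi>(2) by (simp add: na_solution_def)
  from holds_perm_form[OF assms(2) this]
  have "holds (subst_form (perm_form (\<lambda>c. \<mu> (\<pi> c)) B) (perm_subst \<mu> \<theta>))"
    by (simp add: perm_subst_form assms(2) \<theta> perm_form_perm \<pi>(1))
  moreover have "(\<lambda>c. \<mu> (\<pi> c)) ` supp_form B \<inter> supp_subst (perm_subst \<mu> \<theta>) = {}"
    using \<pi>(2) is_perm_inj[OF assms(2), of UNIV]
    by (auto simp: supp_perm_subst[OF assms(2)] inj_eq)
  ultimately show ?thesis
    using holds_nom_subst_form[OF is_subst_perm[OF assms(2) \<theta>] is_perm_comp[OF assms(2) \<pi>(1)]]
    by (simp add: na_solution_def is_subst_perm assms(2) \<theta>)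
qed


subsection \<open>Separating the constants of a unifier from those of its instances\<close>

text \<open>The replaced constants occur in neither \<open>u\<close> nor \<open>v\<close>, so
  replacing them commutes with instantiating these two terms. The resulting unifier has no
  constants, which makes \<open>separate_instance\<close> applicable to it.\<close>

lemma unifier_noms_to_vars:
  assumes "unifier u v \<rho>" "\<And>d. vty (z d) = nty d"
  defines "f \<equiv> \<lambda>d. if d \<in> supp_subst \<rho> then tm_var (z d) else tm_nom d"
  shows "unifier u v (\<lambda>x. tm_map f tm_var (\<rho> x))" and "supp (tm_map f tm_var (\<rho> x)) = {}"
proof -
  let ?\<rho> = "\<lambda>x. tm_map f tm_var (\<rho> x)"
  have \<rho>: "is_subst \<rho>" and eq: "tm_subst u \<rho> = tm_subst v \<rho>"
    and disj: "supp_subst \<rho> \<inter> (supp u \<union> supp v) = {}"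
    using assms(1) by (auto simp: unifier_def)
  have ty: "tm_typed f tm_var" by (simp add: tm_typed_def f_def assms(2))
  have \<rho>': "is_subst ?\<rho>"
    by (rule is_subst_finite[of _ "{x. \<rho> x \<noteq> tm_var x}"])
      (use \<rho> in \<open>auto simp: tm_ty_map ty is_subst_def\<close>)
  have sub: "tm_subst w ?\<rho> = tm_map f tm_var (tm_subst w \<rho>)" if "supp_subst \<rho> \<inter> supp w = {}" for w
  proof -
    have "tm_map f tm_var (tm_subst w \<rho>) = tm_map f ?\<rho> w"
      using tm_map_map[OF ty tm_typed_subst[OF \<rho>]] by (simp add: tm_subst_map[OF \<rho>] ty)
    also have "\<dots> = tm_map tm_nom ?\<rho> w"
      by (rule tm_map_cong)
        (use that tm_typed_subst[OF \<rho>'] ty in \<open>auto simp: tm_typed_def f_def\<close>)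
    finally show ?thesis by (simp add: tm_subst_map[OF \<rho>'])
  qed
  show supp: "supp (?\<rho> x) = {}" for x
    using supp_map[OF ty, of "\<rho> x"] supp_subst_mem[of _ \<rho> x] by (auto simp: f_def split: if_splits)
  show "unifier u v ?\<rho>"
  proof -
    have "tm_subst u ?\<rho> = tm_subst v ?\<rho>"
      using sub[of u] sub[of v] eq disj by (simp add: Int_Un_distrib)
    moreover have "supp_subst ?\<rho> = {}" using supp by (simp add: supp_subst_def)
    ultimately show ?thesis using \<rho>' by (simp add: unifier_def)
  qed
qed

text \<open>\<gamma>' is \<gamma> with its constants moved by \<kappa>, and \<delta> undoes
  \<kappa>, hence maps the new instance to the old one. As \<theta> and \<gamma> may share
  constants, \<delta> can identify constants; but if the old instance has none,
  \<open>tm_map_identify\<close> shows that \<delta> changed nothing.\<close>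

lemma separate_instance:
  assumes "is_subst \<theta>" "is_subst \<gamma>" "finite Y"
  obtains \<gamma>' where "is_subst \<gamma>'" "supp_subst \<gamma>' \<inter> Y = {}"
    "\<And>x. supp (comp_subst \<theta> \<gamma> x) = {} \<Longrightarrow> comp_subst \<theta> \<gamma>' x = comp_subst \<theta> \<gamma> x"
proof -
  let ?Y = "Y \<union> supp_subst \<gamma> \<union> supp_subst \<theta>"
  have "finite ?Y" "finite (supp_subst \<gamma>)" using assms finite_supp_subst by auto
  then obtain \<kappa> where \<kappa>: "is_perm \<kappa>" "\<kappa> ` supp_subst \<gamma> \<inter> ?Y = {}"
    by (metis perm_fresh)
  define \<delta> where "\<delta> c = (if c \<in> \<kappa> ` supp_subst \<gamma> then inv \<kappa> c else c)" for c
  have "{c. \<delta> c \<noteq> c} \<subseteq> \<kappa> ` supp_subst \<gamma>" by (auto simp: \<delta>_def)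
  then have fin: "finite {c. \<delta> c \<noteq> c}"
    by (rule finite_subset) (simp add: finite_supp_subst assms(2))
  have nty: "nty (\<delta> c) = nty c" for c
    by (simp add: \<delta>_def is_perm_nty[OF is_perm_inv(1)[OF \<kappa>(1)]])
  have ty: "tm_typed (\<lambda>c. tm_nom (\<delta> c)) tm_var" by (rule tm_typed_perm[OF nty])
  let ?\<gamma> = "perm_subst \<kappa> \<gamma>"
  have \<gamma>: "is_subst ?\<gamma>" by (rule is_subst_perm[OF \<kappa>(1) assms(2)])
  have \<delta>\<gamma>: "tm_map (\<lambda>c. tm_nom (\<delta> c)) tm_var (?\<gamma> y) = \<gamma> y" for y
  proof -
    have "tm_map (\<lambda>c. tm_nom (\<delta> c)) tm_var (?\<gamma> y) = tm_map (\<lambda>c. tm_nom (\<delta> (\<kappa> c))) tm_var (\<gamma> y)"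
      using tm_map_map[OF ty is_perm_map(2)[OF \<kappa>(1)]]
      by (simp add: perm_subst_def is_perm_map(1)[OF \<kappa>(1)] ty)
    also have "\<dots> = tm_map tm_nom tm_var (\<gamma> y)"
      by (rule tm_map_cong)
        (auto simp: tm_typed_def nty is_perm_nty[OF \<kappa>(1)] \<delta>_def is_perm_inv(2)[OF \<kappa>(1)] supp_subst_mem)
    finally show ?thesis by simp
  qed
  have \<delta>comp: "tm_map (\<lambda>c. tm_nom (\<delta> c)) tm_var (comp_subst \<theta> ?\<gamma> x) = comp_subst \<theta> \<gamma> x" for x
  proof -
    have "tm_map (\<lambda>c. tm_nom (\<delta> c)) tm_var (comp_subst \<theta> ?\<gamma> x) =
        tm_map (\<lambda>c. tm_nom (\<delta> c)) \<gamma> (\<theta> x)"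
      using tm_map_map[OF ty tm_typed_subst[OF \<gamma>]]
      by (simp add: comp_subst_def tm_subst_map[OF \<gamma>] ty \<delta>\<gamma>)
    \<comment> \<open>The images under \<kappa> avoid the constants of \<theta>, so \<delta> acts
      only on those contributed by the renamed \<gamma>.\<close>
    also have "\<dots> = tm_map tm_nom \<gamma> (\<theta> x)"
    proof (rule tm_map_cong)
      fix c assume "c \<in> supp (\<theta> x)"
      then have "c \<in> supp_subst \<theta>" by (rule supp_subst_mem)
      then have "c \<notin> \<kappa> ` supp_subst \<gamma>" using \<kappa>(2) by auto
      then show "tm_nom (\<delta> c) = tm_nom c" by (simp add: \<delta>_def)
    qed (use assms(2) in \<open>auto simp: tm_typed_def nty is_subst_ty\<close>)
    finally show ?thesis by (simp add: comp_subst_def tm_subst_map[OF assms(2)])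
  qed
  show ?thesis
  proof (rule that[OF \<gamma>])
    show "supp_subst ?\<gamma> \<inter> Y = {}" using \<kappa>(2) by (auto simp: supp_perm_subst[OF \<kappa>(1)])
    fix x assume "supp (comp_subst \<theta> \<gamma> x) = {}"
    then show "comp_subst \<theta> ?\<gamma> x = comp_subst \<theta> \<gamma> x"
      using tm_map_identify[OF fin nty, of "comp_subst \<theta> ?\<gamma> x"] \<delta>comp[of x] by simp
  qed
qed


subsection \<open>Raising\<close>

lemma Funs_inject: "length As = length Bs \<Longrightarrow> Funs As C = Funs Bs D \<longleftrightarrow> As = Bs \<and> C = D"
  by (induction As Bs rule: list_induct2) auto

locale raised_problem =
  fixes \<Sigma> :: "var set" and s t :: "'k::signature tm" and cs :: "nom list" and prime :: "var \<Rightarrow> var"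
  assumes finite_\<Sigma>: "finite \<Sigma>"
    and fv_\<Sigma>: "fv s \<union> fv t \<subseteq> \<Sigma>"
    and ty_s: "tm_ty s = Funs (map nty cs) (tm_ty t)"
    and distinct_cs: "distinct cs"
    and fresh_cs: "set cs \<inter> (supp s \<union> supp t) = {}"
    and inj_prime: "inj_on prime \<Sigma>"
    and vty_prime: "\<And>h. h \<in> \<Sigma> \<Longrightarrow> vty (prime h) = Funs (map nty cs) (vty h)"
begin

abbreviation \<sigma> :: "'k subst" where "\<sigma> \<equiv> raising \<Sigma> prime cs"

lemma raising_apps: "h \<in> \<Sigma> \<Longrightarrow> \<sigma> h = tm_apps (tm_var (prime h)) cs"
  using tm_apps_abs[of "Free (prime h)" cs "vty h"] vty_prime by (simp add: raising_def tm_var_def)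

lemma is_subst_raising: "is_subst \<sigma>"
proof (rule is_subst_finite[OF _ finite_\<Sigma>])
  show "tm_ty (\<sigma> h) = vty h" for h
    using raising_apps[of h] vty_prime[of h]
    by (cases "h \<in> \<Sigma>") (simp_all add: tm_ty_apps raising_def)
qed (simp add: raising_def)

lemma supp_raising: "supp_subst \<sigma> \<subseteq> set cs"
proof -
  have "supp (\<sigma> h) \<subseteq> set cs" for h
    using raising_apps[of h] supp_apps[of "tm_var (prime h)" cs "vty h"] vty_prime[of h]
    by (cases "h \<in> \<Sigma>") (simp_all add: raising_def)
  then show ?thesis by (auto simp: supp_subst_def)
qed

section \<open>Soundness of raised unifiers\<close>

lemma nom_comp_solution:
  assumes "supp (tm_subst s \<sigma>) \<union> supp (tm_subst t \<sigma>) \<subseteq> set as \<union> set bs"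
    and "distinct as" "length as = length cs"
    and "unifier (lam_noms bs (tm_subst s \<sigma>)) (lam_noms bs (lam_noms as (tm_subst t \<sigma>))) \<rho>"
  shows "na_solution (NAbs (length cs) s t) (nom_comp \<sigma> \<rho>)"
proof -
  let ?s = "tm_subst s \<sigma>" and ?t = "tm_subst t \<sigma>" and ?B = "NAbs (length cs) s t"
  let ?u = "lam_noms bs ?s" and ?v = "lam_noms bs (lam_noms as ?t)"
  let ?F = "supp s \<union> supp t \<union> set cs \<union> set as \<union> set bs"
  have \<rho>: "is_subst \<rho>" and eq: "tm_subst ?u \<rho> = tm_subst ?v \<rho>" and disj: "supp_subst \<rho> \<inter> supp ?u = {}"
    using assms(4) by (auto simp: unifier_def)
  have fin: "finite ?F" by simp
  obtain \<pi> where \<pi>: "is_perm \<pi>" "\<And>c. c \<in> supp ?u \<Longrightarrow> \<pi> c = c" "\<pi> ` (?F - supp ?u) \<inter> supp_subst \<rho> = {}"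
    by (rule perm_avoid[OF fin finite_supp[of ?u] finite_supp_subst[OF \<rho>]]) blast
  have F: "\<pi> c \<notin> supp_subst \<rho>" if "c \<in> ?F" for c
  proof (cases "c \<in> supp ?u")
    case True
    then show ?thesis using \<pi>(2)[OF True] disj by auto
  next
    case False
    then show ?thesis using \<pi>(3) that by blast
  qed
  \<comment> \<open>On the right \<open>bs\<close> and \<open>as\<close> bind every constant; on the
    left members of \<open>as\<close> may remain free, and these are the ones that \<pi>
    fixes.\<close>
  have "supp ?v = {}"
    using supp_lam_noms[of bs "lam_noms as ?t"] supp_lam_noms[of as ?t] assms(1) by blast
  then have "tm_perm \<pi> ?u = ?u" "tm_perm \<pi> ?v = ?v"
    by (auto intro!: tm_perm_ident \<pi>(1,2))
  \<comment> \<open>\<pi> fixes both terms of the problem, so moving it through the abstractions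
    presents the same terms with abstracted constants that \<rho> avoids.\<close>
  with eq have "tm_subst (lam_noms (map \<pi> bs) (tm_perm \<pi> ?s)) \<rho> =
      tm_subst (lam_noms (map \<pi> bs) (lam_noms (map \<pi> as) (tm_perm \<pi> ?t))) \<rho>"
    by (simp add: perm_lam_noms[OF \<pi>(1)])
  moreover have bs: "set (map \<pi> bs) \<inter> supp_subst \<rho> = {}" and as: "set (map \<pi> as) \<inter> supp_subst \<rho> = {}"
    using F by auto
  ultimately have "lam_noms (map \<pi> bs) (tm_subst (tm_perm \<pi> ?s) \<rho>) =
      lam_noms (map \<pi> bs) (lam_noms (map \<pi> as) (tm_subst (tm_perm \<pi> ?t) \<rho>))"
    by (simp only: subst_lam_noms[OF \<rho> bs] subst_lam_noms[OF \<rho> as])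
  then have key: "tm_subst (tm_perm \<pi> ?s) \<rho> = lam_noms (map \<pi> as) (tm_subst (tm_perm \<pi> ?t) \<rho>)"
    by (rule lam_noms_inj)
  let ?\<sigma> = "perm_subst \<pi> \<sigma>" and ?\<theta> = "comp_subst (perm_subst \<pi> \<sigma>) \<rho>"
  have \<sigma>: "is_subst ?\<sigma>" by (rule is_subst_perm[OF \<pi>(1) is_subst_raising])
  have \<theta>: "is_subst ?\<theta>" by (rule is_subst_comp[OF \<sigma> \<rho>])
  have "tm_subst (tm_perm \<pi> s) ?\<theta> = lam_noms (map \<pi> as) (tm_subst (tm_perm \<pi> t) ?\<theta>)"
    using key by (simp add: tm_perm_subst[OF \<pi>(1) is_subst_raising] tm_subst_subst[OF \<sigma> \<rho>])
  moreover have "length (map \<pi> as) = length cs" "distinct (map \<pi> as)"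
    using assms(2,3) is_perm_inj[OF \<pi>(1)] by (auto simp: distinct_map)
  ultimately have "holds (subst_form (perm_form \<pi> ?B) ?\<theta>)"
    unfolding perm_form.simps subst_form.simps holds.simps by blast
  moreover have supp\<sigma>: "supp_subst ?\<sigma> \<subseteq> \<pi> ` set cs"
    using supp_raising by (auto simp: supp_perm_subst[OF \<pi>(1)])
  have "\<pi> ` (supp s \<union> supp t) \<inter> \<pi> ` set cs = {}"
    using fresh_cs is_perm_inj[OF \<pi>(1), of UNIV] by (auto simp: inj_eq)
  then have "\<pi> ` supp_form ?B \<inter> supp_subst ?\<theta> = {}"
    using supp\<sigma> supp_comp_subst[OF \<rho>, of ?\<sigma>] F by fastforce
  ultimately have sol: "na_solution ?B ?\<theta>"
    using holds_nom_subst_form[OF \<theta> \<pi>(1)] \<theta> by (simp add: na_solution_def)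
  \<comment> \<open>\<open>nom_comp\<close> may have chosen another permutation for \<sigma>; the
    two composites differ by \<mu>, and solutions are closed under renaming.\<close>
  have "supp_subst ?\<sigma> \<inter> supp_subst \<rho> = {}" using supp\<sigma> F by fastforce
  then obtain \<mu> where \<mu>: "is_perm \<mu>" "?\<theta> = perm_subst \<mu> (nom_comp \<sigma> \<rho>)"
    by (rule nom_comp_equiv[OF is_subst_raising \<rho> \<pi>(1)])
  from na_solution_perm[OF sol is_perm_inv(1)[OF \<mu>(1)]] show ?thesis
    unfolding \<mu>(2) perm_subst_inv[OF \<mu>(1)] .
qed

text \<open>A solution may abstract arbitrary constants, a selection only those of \<open>t\<close>
  and \<open>cs\<close>. The gap is closed by renaming \<rho> off all constants in sight, renaming
  vacuously abstracted constants, and sending the abstracted constants foreign to \<open>t\<close>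
  to \<open>cs\<close>.\<close>

lemma normalize_solution:
  assumes "na_solution (NAbs (length cs) s t) \<rho>"
  obtains \<mu> as where "is_perm \<mu>" "as \<in> selections t cs"
    "tm_subst s (perm_subst \<mu> \<rho>) = lam_noms as (tm_subst t (perm_subst \<mu> \<rho>))"
    "supp_subst (perm_subst \<mu> \<rho>) \<inter> (supp s \<union> supp t) = {}"
proof -
  let ?B = "NAbs (length cs) s t"
  have \<rho>: "is_subst \<rho>" using assms by (simp add: na_solution_def)
  have "finite (supp s \<union> supp t \<union> set cs)" by simp
  then obtain \<mu>0 where \<mu>0: "is_perm \<mu>0" "\<mu>0 ` supp_subst \<rho> \<inter> (supp s \<union> supp t \<union> set cs) = {}"
    by (rule perm_fresh[OF finite_supp_subst[OF \<rho>]])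
  define \<rho>0 where "\<rho>0 = perm_subst \<mu>0 \<rho>"
  have \<rho>0: "is_subst \<rho>0" unfolding \<rho>0_def by (rule is_subst_perm[OF \<mu>0(1) \<rho>])
  have disj0: "supp_subst \<rho>0 \<inter> (supp s \<union> supp t \<union> set cs) = {}"
    using \<mu>0(2) by (simp add: \<rho>0_def supp_perm_subst[OF \<mu>0(1)])
  have "na_solution ?B \<rho>0" unfolding \<rho>0_def by (rule na_solution_perm[OF assms \<mu>0(1)])
  moreover have "id ` supp_form ?B \<inter> supp_subst \<rho>0 = {}" using disj0 by auto
  ultimately have "holds (subst_form (perm_form id ?B) \<rho>0)"
    using holds_nom_subst_form[OF \<rho>0 is_perm_id] by (simp add: na_solution_def)
  then obtain ds0 where ds0: "length ds0 = length cs" "distinct ds0"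
    "tm_subst s \<rho>0 = lam_noms ds0 (tm_subst t \<rho>0)" by auto
  \<comment> \<open>Constants outside \<open>?K\<close> do not occur in \<open>t\<close> under
    \<open>\<rho>0\<close>; abstracting them is vacuous, so \<nu> may rename them without changing
    the abstraction.\<close>
  let ?K = "supp t \<union> supp_subst \<rho>0"
  have "finite ?K" "finite (supp s \<union> supp t \<union> set cs)"
    using finite_supp_subst[OF \<rho>0] by auto
  then obtain \<nu> where \<nu>: "is_perm \<nu>" "\<And>c. c \<in> ?K \<Longrightarrow> \<nu> c = c"
    "\<nu> ` (set ds0 - ?K) \<inter> (supp s \<union> supp t \<union> set cs) = {}"
    by (rule perm_avoid[OF finite_set[of ds0]]) blast
  define ds where "ds = map \<nu> ds0"
  have suppt: "supp (tm_subst t \<rho>0) \<subseteq> ?K" by (rule supp_tm_subst[OF \<rho>0])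
  then have "tm_perm \<nu> (tm_subst t \<rho>0) = tm_subst t \<rho>0"
    "tm_perm \<nu> (lam_noms ds0 (tm_subst t \<rho>0)) = lam_noms ds0 (tm_subst t \<rho>0)"
    using supp_lam_noms[of ds0 "tm_subst t \<rho>0"] by (blast intro: tm_perm_ident[OF \<nu>(1)] \<nu>(2))+
  then have ds: "tm_subst s \<rho>0 = lam_noms ds (tm_subst t \<rho>0)"
    using ds0(3) by (simp add: perm_lam_noms[OF \<nu>(1)] ds_def)
  have len: "length ds = length cs" and dist: "distinct ds"
    using ds0(1,2) is_perm_inj[OF \<nu>(1)] by (auto simp: ds_def distinct_map)
  have "Funs (map nty ds) (tm_ty t) = Funs (map nty cs) (tm_ty t)"
    using arg_cong[OF ds, of tm_ty] by (simp add: tm_ty_subst \<rho>0 ty_s)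
  then have nty_ds: "map nty ds = map nty cs" by (simp add: Funs_inject len)
  have ds_cases: "d \<notin> supp s \<union> supp t \<union> set cs" if "d \<in> set ds" "d \<notin> supp t" for d
  proof -
    from that(1) obtain c where c: "c \<in> set ds0" "d = \<nu> c" by (auto simp: ds_def)
    show ?thesis
    proof (cases "c \<in> ?K")
      case True
      then have "d = c" using \<nu>(2) c(2) by simp
      then show ?thesis using True that(2) disj0 by blast
    next
      case False
      then show ?thesis using \<nu>(3) c by blast
    qed
  qed
  \<comment> \<open>A foreign constant at position i goes to \<open>cs ! i\<close>, which has the
    same type; those of \<open>t\<close> are already allowed in a selection. Fixing the constants of
    \<open>s\<close> and \<open>t\<close> keeps the equation one about the original terms.\<close>
  define f where "f d = (if d \<in> supp s \<union> supp t then d else the (map_of (zip ds cs) d))" for d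
  have f_id: "f d = d" if "d \<in> supp s \<union> supp t" for d using that by (simp add: f_def)
  have f_ds: "f (ds ! i) = cs ! i" if "i < length cs" "ds ! i \<notin> supp t" for i
    using ds_cases[of "ds ! i"] that len map_of_zip_nth[OF len dist, of i] by (simp add: f_def)
  let ?D = "set ds - supp t" and ?X = "supp s \<union> supp t"
  have inj_D: "inj_on f ?D"
  proof (rule inj_onI)
    fix a b assume "a \<in> ?D" "b \<in> ?D" and eq: "f a = f b"
    then obtain i j where ij: "i < length cs" "a = ds ! i" "j < length cs" "b = ds ! j"
      "ds ! i \<notin> supp t" "ds ! j \<notin> supp t"
      by (metis DiffE in_set_conv_nth len)
    with eq have "cs ! i = cs ! j" by (simp add: f_ds)
    with ij show "a = b" using distinct_cs nth_eq_iff_index_eq by blast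
  qed
  have f_D: "f d \<in> set cs \<and> nty (f d) = nty d" if "d \<in> ?D" for d
  proof -
    from that obtain i where i: "i < length cs" "d = ds ! i" "ds ! i \<notin> supp t"
      by (metis DiffE in_set_conv_nth len)
    then show ?thesis
      using f_ds nty_ds len by (metis nth_map nth_mem)
  qed
  have "f ` ?X = ?X" using f_id by force
  then have "f ` (?D - ?X) \<inter> f ` (?X - ?D) = {}" using f_D fresh_cs by blast
  moreover have "inj_on f ?X" using f_id by (simp add: inj_on_def)
  ultimately have "inj_on f (?D \<union> ?X)" using inj_D inj_on_Un[of f ?D ?X] by blast
  moreover have "nty (f d) = nty d" if "d \<in> ?D \<union> ?X" for d
    using that f_D f_id by (cases "d \<in> ?X") auto
  ultimately have "\<exists>\<mu>. is_perm \<mu> \<and> (\<forall>d \<in> ?D \<union> ?X. \<mu> d = f d)"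
    by (intro perm_extend) auto
  then obtain \<mu>1 where \<mu>1: "is_perm \<mu>1" "\<And>d. d \<in> ?D \<union> ?X \<Longrightarrow> \<mu>1 d = f d" by blast
  have \<mu>1_id: "\<mu>1 d = d" if "d \<in> ?X" for d using that \<mu>1(2) f_id by simp
  define as where "as = map \<mu>1 ds"
  have "\<mu>1 d \<in> supp t \<union> set cs" if "d \<in> set ds" for d
    using that \<mu>1(2)[of d] \<mu>1_id[of d] f_D[of d] by (cases "d \<in> supp t") auto
  then have "as \<in> selections t cs"
    using nty_ds dist is_perm_inj[OF \<mu>1(1)]
    by (auto simp: selections_def as_def distinct_map is_perm_nty[OF \<mu>1(1)] comp_def)
  moreover have "tm_perm \<mu>1 s = s" "tm_perm \<mu>1 t = t"
    using \<mu>1_id by (auto intro: tm_perm_ident[OF \<mu>1(1)])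
  then have "tm_subst s (perm_subst \<mu>1 \<rho>0) = lam_noms as (tm_subst t (perm_subst \<mu>1 \<rho>0))"
    using arg_cong[OF ds, of "tm_perm \<mu>1"]
    by (simp add: tm_perm_subst[OF \<mu>1(1) \<rho>0] perm_lam_noms[OF \<mu>1(1)] as_def)
  moreover have "supp_subst (perm_subst \<mu>1 \<rho>0) \<inter> ?X = {}"
  proof -
    have "\<mu>1 c \<notin> ?X" if "c \<in> supp_subst \<rho>0" for c
    proof
      assume "\<mu>1 c \<in> ?X"
      then have "\<mu>1 (\<mu>1 c) = \<mu>1 c" by (rule \<mu>1_id)
      then have "\<mu>1 c = c" using is_perm_inj[OF \<mu>1(1), of UNIV] by (simp add: inj_eq)
      with \<open>\<mu>1 c \<in> ?X\<close> that disj0 show False by auto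
    qed
    then show ?thesis by (auto simp: supp_perm_subst[OF \<mu>1(1)])
  qed
  moreover have "perm_subst \<mu>1 \<rho>0 = perm_subst (\<lambda>c. \<mu>1 (\<mu>0 c)) \<rho>"
    unfolding \<rho>0_def by (rule perm_subst_perm[OF \<mu>1(1) \<mu>0(1)])
  ultimately show ?thesis using that is_perm_comp[OF \<mu>1(1) \<mu>0(1)] by metis
qed

section \<open>Lowering: from a solution to a unifier\<close>

definition lower :: "'k subst \<Rightarrow> 'k subst" where
  "lower \<rho> = (\<lambda>x. if x \<in> prime ` \<Sigma> then lam_noms cs (\<rho> (the_inv_into \<Sigma> prime x)) else tm_var x)"

lemma lower_prime: "h \<in> \<Sigma> \<Longrightarrow> lower \<rho> (prime h) = lam_noms cs (\<rho> h)"
  by (simp add: lower_def the_inv_into_f_f[OF inj_prime])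

lemma is_subst_lower:
  assumes "is_subst \<rho>"
  shows "is_subst (lower \<rho>)"
proof (rule is_subst_finite)
  show "tm_ty (lower \<rho> x) = vty x" for x
  proof (cases "x \<in> prime ` \<Sigma>")
    case True
    then show ?thesis using lower_prime vty_prime is_subst_ty[OF assms] by auto
  qed (simp add: lower_def)
  show "finite (prime ` \<Sigma>)" using finite_\<Sigma> by simp
qed (simp add: lower_def)

text \<open>Here raising pays off: the normalised \<rho> may mention \<open>cs\<close>, whereas a
  unifier must not mention constants of the problem. The abstraction removes them.\<close>

lemma supp_lower: "supp_subst (lower \<rho>) \<subseteq> supp_subst \<rho> - set cs"
proof -
  have "supp (lower \<rho> x) \<subseteq> supp_subst \<rho> - set cs" for x
  proof (cases "x \<in> prime ` \<Sigma>")
    case True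
    then obtain h where "h \<in> \<Sigma>" "x = prime h" by blast
    then show ?thesis
      using supp_lam_noms[of cs "\<rho> h"] supp_subst_mem[of _ \<rho> h] by (auto simp: lower_prime)
  qed (simp add: lower_def)
  then show ?thesis by (auto simp: supp_subst_def)
qed

lemma apps_lower: "h \<in> \<Sigma> \<Longrightarrow> tm_apps (lower \<rho> (prime h)) cs = \<rho> h"
  by (simp add: lower_prime apps_lam_noms)

lemma subst_raising_lower:
  assumes "is_subst \<rho>" "fv u \<subseteq> \<Sigma>"
  shows "tm_subst (tm_subst u \<sigma>) (lower \<rho>) = tm_subst u \<rho>"
proof -
  note l = is_subst_lower[OF assms(1)]
  have "comp_subst \<sigma> (lower \<rho>) h = \<rho> h" if "h \<in> \<Sigma>" for h
    using that subst_apps[OF l, of "tm_var (prime h)" cs "vty h"]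
    by (simp add: comp_subst_def raising_apps vty_prime l apps_lower)
  then show ?thesis
    unfolding tm_subst_subst[OF is_subst_raising l]
    using assms by (intro tm_subst_cong is_subst_comp is_subst_raising l) auto
qed

lemma unifier_lower:
  assumes "is_subst \<rho>" "tm_subst s \<rho> = lam_noms as (tm_subst t \<rho>)"
    and "supp_subst \<rho> \<inter> (supp s \<union> supp t) = {}"
    and "set as \<subseteq> supp t \<union> set cs"
    and "set bs \<subseteq> supp (tm_subst s \<sigma>) \<union> supp (tm_subst t \<sigma>)"
  shows "unifier (lam_noms bs (tm_subst s \<sigma>)) (lam_noms bs (lam_noms as (tm_subst t \<sigma>))) (lower \<rho>)"
proof -
  note l = is_subst_lower[OF assms(1)]
  have disj: "supp_subst (lower \<rho>) \<inter> (supp s \<union> supp t \<union> set cs) = {}"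
    using supp_lower[of \<rho>] assms(3) by blast
  have sub: "supp (tm_subst s \<sigma>) \<union> supp (tm_subst t \<sigma>) \<subseteq> supp s \<union> supp t \<union> set cs"
    using supp_tm_subst[OF is_subst_raising, of s] supp_tm_subst[OF is_subst_raising, of t]
      supp_raising by blast
  have as: "set as \<inter> supp_subst (lower \<rho>) = {}" using assms(4) disj by blast
  have bs: "set bs \<inter> supp_subst (lower \<rho>) = {}" using assms(5) sub disj by blast
  have "tm_subst (tm_subst s \<sigma>) (lower \<rho>) = lam_noms as (tm_subst (tm_subst t \<sigma>) (lower \<rho>))"
    using assms(2) fv_\<Sigma> by (simp add: subst_raising_lower[OF assms(1)])
  moreover have "supp (lam_noms bs (tm_subst s \<sigma>)) \<union> supp (lam_noms bs (lam_noms as (tm_subst t \<sigma>)))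
      \<subseteq> supp (tm_subst s \<sigma>) \<union> supp (tm_subst t \<sigma>)"
    using supp_lam_noms[of bs] supp_lam_noms[of as "tm_subst t \<sigma>"] by blast
  ultimately show ?thesis
    using l disj sub by (simp add: unifier_def subst_lam_noms[OF l as] subst_lam_noms[OF l bs]) blast
qed

text \<open>\<open>z\<close> hides the constants of \<rho>' in variables so that the covering
  instance can be separated from \<theta>; afterwards \<zeta> turns these variables back into
  constants, renamed by \<kappa>. The renaming keeps them apart from
  \<open>nom_comp \<sigma> \<theta>\<close> and is harmless since \<open>less_general_on\<close>
  compares up to permutation.\<close>

lemma complete_unifiers_less_general:
  assumes \<rho>: "is_subst \<rho>" and \<mu>: "is_perm \<mu>"
    and unif: "unifier u v (lower (perm_subst \<mu> \<rho>))"
    and compl: "complete_unifiers (prime ` \<Sigma>) u v U"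
  shows "\<exists>\<theta>\<in>U. less_general_on \<Sigma> \<rho> (nom_comp \<sigma> \<theta>)"
proof -
  define \<rho>1 where "\<rho>1 = perm_subst \<mu> \<rho>"
  define \<rho>' where "\<rho>' = lower \<rho>1"
  have \<rho>1: "is_subst \<rho>1" unfolding \<rho>1_def by (rule is_subst_perm[OF \<mu> \<rho>])
  have \<rho>': "is_subst \<rho>'" unfolding \<rho>'_def by (rule is_subst_lower[OF \<rho>1])
  have cs_\<rho>': "set cs \<inter> supp_subst \<rho>' = {}" using supp_lower[of \<rho>1] by (auto simp: \<rho>'_def)
  have "finite (\<Union>x\<in>prime ` \<Sigma>. fv (\<rho>' x))" using finite_\<Sigma> by simp
  then obtain z :: "nom \<Rightarrow> var" where z: "inj z" "\<And>d. vty (z d) = nty d"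
    "range z \<inter> (\<Union>x\<in>prime ` \<Sigma>. fv (\<rho>' x)) = {}" using fresh_vars by metis
  define f :: "nom \<Rightarrow> 'k tm"
    where "f = (\<lambda>d. if d \<in> supp_subst \<rho>' then tm_var (z d) else tm_nom d)"
  have f: "tm_typed f tm_var" by (simp add: tm_typed_def f_def z(2))
  have "unifier u v \<rho>'" using unif by (simp add: \<rho>'_def \<rho>1_def)
  note uv = unifier_noms_to_vars[OF this z(2), folded f_def]
  have "\<exists>\<theta>\<in>U. \<exists>\<gamma>. is_subst \<gamma> \<and>
      (\<forall>x \<in> prime ` \<Sigma> \<union> fv u \<union> fv v. tm_map f tm_var (\<rho>' x) = comp_subst \<theta> \<gamma> x)"
    using compl uv(1) by (simp add: complete_unifiers_def)
  then obtain \<theta> \<gamma> where \<theta>U: "\<theta> \<in> U" and \<gamma>: "is_subst \<gamma>"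
    and inst: "\<And>x. x \<in> prime ` \<Sigma> \<Longrightarrow> tm_map f tm_var (\<rho>' x) = comp_subst \<theta> \<gamma> x"
    by blast
  have \<theta>: "is_subst \<theta>" using compl \<theta>U by (simp add: complete_unifiers_def unifier_def)
  obtain \<pi> where \<pi>: "is_perm \<pi>" "nom_comp \<sigma> \<theta> = comp_subst (perm_subst \<pi> \<sigma>) \<theta>"
    using nom_comp_choice[OF is_subst_raising \<theta>] by metis
  \<comment> \<open>These include all constants that \<open>nom_comp \<sigma> \<theta>\<close> can
    contribute on \<Sigma>; the substitution composed with it has to avoid them.\<close>
  let ?Y = "supp_subst \<theta> \<union> \<pi> ` set cs"
  have finY: "finite ?Y" using finite_supp_subst[OF \<theta>] by simp
  obtain \<gamma>1 where \<gamma>1: "is_subst \<gamma>1" "supp_subst \<gamma>1 \<inter> ?Y = {}"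
    "\<And>x. supp (comp_subst \<theta> \<gamma> x) = {} \<Longrightarrow> comp_subst \<theta> \<gamma>1 x = comp_subst \<theta> \<gamma> x"
    by (rule separate_instance[OF \<theta> \<gamma> finY]) blast
  obtain g :: "nom \<Rightarrow> nom" where g: "inj g" "\<And>c. nty (g c) = nty c" "range g \<inter> ?Y = {}"
    by (rule fresh_names[OF finY]) blast
  \<comment> \<open>On \<open>cs\<close> the renaming has to agree with the \<pi> chosen by
    \<open>nom_comp\<close>, since there the values of \<theta> are applied to
    \<open>map \<pi> cs\<close>; the constants of \<rho>' go outside \<open>?Y\<close>. The two
    demands are compatible as \<rho>' avoids \<open>cs\<close>.\<close>
  define k where "k c = (if c \<in> set cs then \<pi> c else g c)" for c
  have k_cs: "k c = \<pi> c" if "c \<in> set cs" for c using that by (simp add: k_def)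
  have k_g: "k c = g c" if "c \<in> supp_subst \<rho>'" for c
    using that cs_\<rho>' by (auto simp: k_def)
  have "inj_on k (set cs \<union> supp_subst \<rho>')"
  proof -
    have "inj_on k (set cs)" "inj_on k (supp_subst \<rho>')"
      using k_cs k_g is_perm_inj[OF \<pi>(1), of "set cs"] g(1) by (simp_all add: inj_on_def)
    moreover have "k ` set cs \<inter> k ` supp_subst \<rho>' = {}" using k_cs k_g g(3) by fastforce
    ultimately show ?thesis by (auto simp: inj_on_Un)
  qed
  moreover have "nty (k c) = nty c" for c by (simp add: k_def g(2) is_perm_nty[OF \<pi>(1)])
  ultimately have "\<exists>\<kappa>. is_perm \<kappa> \<and> (\<forall>c \<in> set cs \<union> supp_subst \<rho>'. \<kappa> c = k c)"
    using finite_supp_subst[OF \<rho>'] by (intro perm_extend) auto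
  then obtain \<kappa> where \<kappa>: "is_perm \<kappa>" "\<And>c. c \<in> set cs \<Longrightarrow> \<kappa> c = \<pi> c"
    "\<And>c. c \<in> supp_subst \<rho>' \<Longrightarrow> \<kappa> c = g c"
    using k_cs k_g by auto
  define \<zeta> where "\<zeta> x = (if x \<in> z ` supp_subst \<rho>' then tm_nom (\<kappa> (inv z x)) else tm_var x :: 'k tm)" for x
  have \<zeta>_z: "\<zeta> (z d) = tm_nom (\<kappa> d)" if "d \<in> supp_subst \<rho>'" for d
    using that by (simp add: \<zeta>_def inv_f_f[OF z(1)])
  have \<zeta>: "is_subst \<zeta>"
  proof (rule is_subst_finite)
    show "tm_ty (\<zeta> x) = vty x" for x
      using z(2) is_perm_nty[OF \<kappa>(1)]
      by (cases "x \<in> z ` supp_subst \<rho>'") (auto simp: \<zeta>_def inv_f_f[OF z(1)])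
    show "finite (z ` supp_subst \<rho>')" using finite_supp_subst[OF \<rho>'] by simp
  qed (simp add: \<zeta>_def)
  have supp\<zeta>: "supp_subst \<zeta> \<inter> ?Y = {}"
  proof -
    have "supp (\<zeta> x) \<subseteq> range g" for x
    proof (cases "x \<in> z ` supp_subst \<rho>'")
      case True
      then obtain d where "d \<in> supp_subst \<rho>'" "x = z d" by blast
      then show ?thesis using \<zeta>_z supp_nom[of "g d"] \<kappa>(3) by auto
    qed (simp add: \<zeta>_def)
    then show ?thesis using g(3) unfolding supp_subst_def by blast
  qed
  define \<gamma>' where "\<gamma>' = comp_subst \<gamma>1 \<zeta>"
  have \<gamma>': "is_subst \<gamma>'" unfolding \<gamma>'_def by (rule is_subst_comp[OF \<gamma>1(1) \<zeta>])
  have supp\<gamma>': "supp_subst \<gamma>' \<inter> ?Y = {}"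
    using supp_comp_subst[OF \<zeta>, of \<gamma>1] supp\<zeta> \<gamma>1(2) unfolding \<gamma>'_def by blast
  have \<theta>\<gamma>': "tm_subst (\<theta> x) \<gamma>' = tm_perm \<kappa> (\<rho>' x)" if x: "x \<in> prime ` \<Sigma>" for x
  proof -
    have "supp (comp_subst \<theta> \<gamma> x) = {}" using inst[OF x] uv(2)[of x] by simp
    from \<gamma>1(3)[OF this] have "tm_subst (\<theta> x) \<gamma>1 = tm_map f tm_var (\<rho>' x)"
      using inst[OF x] by (simp add: comp_subst_def)
    then have "tm_subst (\<theta> x) \<gamma>' = tm_map tm_nom \<zeta> (tm_map f tm_var (\<rho>' x))"
      unfolding \<gamma>'_def by (simp add: tm_subst_subst[OF \<gamma>1(1) \<zeta>, symmetric] tm_subst_map[OF \<zeta>])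
    also have "\<dots> = tm_map (\<lambda>d. tm_map tm_nom \<zeta> (f d)) \<zeta> (\<rho>' x)"
      using tm_map_map[OF tm_typed_subst[OF \<zeta>] f] by (simp add: tm_typed_subst[OF \<zeta>])
    also have "\<dots> = tm_map (\<lambda>d. tm_nom (\<kappa> d)) tm_var (\<rho>' x)"
    proof (rule tm_map_cong)
      show "tm_typed (\<lambda>d. tm_map tm_nom \<zeta> (f d)) \<zeta>"
        using tm_typed_map[OF tm_typed_subst[OF \<zeta>] f] tm_typed_subst[OF \<zeta>]
        by (simp add: tm_typed_def)
      show "tm_typed (\<lambda>d. tm_nom (\<kappa> d)) tm_var" by (rule is_perm_map(2)[OF \<kappa>(1)])
      show "tm_map tm_nom \<zeta> (f d) = tm_nom (\<kappa> d)" if "d \<in> supp (\<rho>' x)" for d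
        using supp_subst_mem[of d \<rho>' x] that \<zeta>_z[of d] by (simp add: f_def tm_typed_subst[OF \<zeta>])
      show "\<zeta> y = tm_var y" if "y \<in> fv (\<rho>' x)" for y
      proof -
        have "y \<notin> range z" using z(3) x that by blast
        then show ?thesis by (auto simp: \<zeta>_def)
      qed
    qed
    finally show ?thesis by (simp add: is_perm_map(1)[OF \<kappa>(1)])
  qed
  let ?\<Theta> = "restr \<Sigma> (nom_comp \<sigma> \<theta>)"
  have ncomp: "is_subst (nom_comp \<sigma> \<theta>)" by (rule is_subst_nom_comp[OF is_subst_raising \<theta>])
  have \<Theta>: "is_subst ?\<Theta>" by (rule is_subst_restr[OF ncomp])
  have \<Theta>h: "?\<Theta> h = tm_apps (\<theta> (prime h)) (map \<pi> cs)" if h: "h \<in> \<Sigma>" for h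
  proof -
    have "?\<Theta> h = tm_subst (tm_apps (tm_var (prime h)) (map \<pi> cs)) \<theta>"
      using perm_apps[OF \<pi>(1), of "tm_var (prime h) :: 'k tm" cs "vty h"] vty_prime[OF h] h
      by (simp add: restr_def \<pi>(2) comp_subst_def perm_subst_def raising_apps \<pi>(1))
    also have "\<dots> = tm_apps (\<theta> (prime h)) (map \<pi> cs)"
      using subst_apps[OF \<theta>, of "tm_var (prime h)" "map \<pi> cs" "vty h"] vty_prime[OF h]
      by (simp add: \<theta> comp_def is_perm_nty[OF \<pi>(1)])
    finally show ?thesis .
  qed
  have "supp (?\<Theta> h) \<subseteq> ?Y" for h
  proof (cases "h \<in> \<Sigma>")
    case True
    then show ?thesis
      using \<Theta>h[OF True] supp_apps[of "\<theta> (prime h)" "map \<pi> cs" "vty h"] vty_prime[OF True]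
        supp_subst_mem[of _ \<theta> "prime h"]
      by (auto simp: is_subst_ty[OF \<theta>] comp_def is_perm_nty[OF \<pi>(1)])
  qed (simp add: restr_def)
  then have "supp_subst ?\<Theta> \<subseteq> ?Y" by (auto simp: supp_subst_def)
  then have "supp_subst (perm_subst id ?\<Theta>) \<inter> supp_subst \<gamma>' = {}"
    using supp\<gamma>' by (auto simp: supp_perm_subst[OF is_perm_id])
  then obtain \<mu>2 where \<mu>2: "is_perm \<mu>2"
    "comp_subst (perm_subst id ?\<Theta>) \<gamma>' = perm_subst \<mu>2 (nom_comp ?\<Theta> \<gamma>')"
    by (rule nom_comp_equiv[OF \<Theta> \<gamma>' is_perm_id])
  have "comp_subst ?\<Theta> \<gamma>' h = perm_subst \<kappa> \<rho>1 h" if h: "h \<in> \<Sigma>" for h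
  proof -
    have ty: "tm_ty (\<rho>' (prime h)) = Funs (map nty cs) (vty h)"
      using is_subst_ty[OF \<rho>'] vty_prime[OF h] by simp
    have "comp_subst ?\<Theta> \<gamma>' h = tm_apps (tm_perm \<kappa> (\<rho>' (prime h))) (map \<pi> cs)"
      using subst_apps[OF \<gamma>', of "\<theta> (prime h)" "map \<pi> cs" "vty h"] vty_prime[OF h] h
      by (simp add: comp_subst_def \<Theta>h is_subst_ty[OF \<theta>] comp_def is_perm_nty[OF \<pi>(1)] \<theta>\<gamma>')
    \<comment> \<open>Agreement on \<open>cs\<close> lets \<kappa> be pulled out of the application,
      where the arguments \<open>cs\<close> then cancel the abstraction made by
      \<open>lower\<close>.\<close>
    also have "map \<pi> cs = map \<kappa> cs" using \<kappa>(2) by simp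
    also have "tm_apps (tm_perm \<kappa> (\<rho>' (prime h))) (map \<kappa> cs) = tm_perm \<kappa> (\<rho>1 h)"
      using perm_apps[OF \<kappa>(1) ty] apps_lower[OF h, of \<rho>1] by (simp add: \<rho>'_def)
    finally show ?thesis by (simp add: perm_subst_def)
  qed
  then have "restr \<Sigma> (perm_subst \<kappa> \<rho>1) = restr \<Sigma> (comp_subst (perm_subst id ?\<Theta>) \<gamma>')"
    by (auto simp: restr_def perm_subst_def)
  then have "perm_subst \<kappa> (perm_subst \<mu> (restr \<Sigma> \<rho>)) = perm_subst \<mu>2 (restr \<Sigma> (nom_comp ?\<Theta> \<gamma>'))"
    by (simp add: \<mu>2 \<rho>1_def restr_perm_subst \<kappa>(1) \<mu>)
  then have "restr \<Sigma> \<rho> = perm_subst (inv \<mu>) (perm_subst (inv \<kappa>) (perm_subst \<mu>2 (restr \<Sigma> (nom_comp ?\<Theta> \<gamma>'))))"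
    using perm_subst_inv[OF \<mu>, of "restr \<Sigma> \<rho>"] perm_subst_inv[OF \<kappa>(1), of "perm_subst \<mu> (restr \<Sigma> \<rho>)"]
    by simp
  then have "subst_equiv (restr \<Sigma> \<rho>) (restr \<Sigma> (nom_comp ?\<Theta> \<gamma>'))"
    unfolding subst_equiv_def
    using perm_subst_perm is_perm_comp is_perm_inv(1)[OF \<mu>] is_perm_inv(1)[OF \<kappa>(1)] \<mu>2(1) by metis
  then show ?thesis using \<theta>U \<gamma>' by (auto simp: less_general_on_def)
qed

end

theorem theorem3p14:
  fixes \<Sigma> :: "var set"
    and s t :: "'k::signature tm"
    and \<tau>s :: "ty list" and \<tau> :: ty
    and cs :: "nom list"
    and prime :: "var \<Rightarrow> var"
    and bs :: "nom list \<Rightarrow> nom list"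
    and CSU :: "'k tm \<Rightarrow> 'k tm \<Rightarrow> 'k subst set"
  assumes "finite \<Sigma>"
    and "fv s \<union> fv t \<subseteq> \<Sigma>"
    and "tm_ty s = Funs \<tau>s \<tau>"
    and "tm_ty t = \<tau>"
    and "distinct cs"
    and "map nty cs = \<tau>s"
    and "set cs \<inter> supp_form (NAbs (length \<tau>s) s t) = {}"
    and "inj_on prime \<Sigma>"
    and "prime ` \<Sigma> \<inter> \<Sigma> = {}"
    and "\<And>h. h \<in> \<Sigma> \<Longrightarrow> vty (prime h) = Funs \<tau>s (vty h)"
    and "\<And>as. as \<in> selections t cs \<Longrightarrow>
          distinct (bs as) \<and>
          set (bs as) = (supp (tm_subst s (raising \<Sigma> prime cs)) \<union>
                         supp (tm_subst t (raising \<Sigma> prime cs))) - set as"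
    and "\<And>u v. complete_unifiers (prime ` \<Sigma>) u v (CSU u v)"
  shows "complete_na_solutions \<Sigma> (NAbs (length \<tau>s) s t)
          (solution_set prime cs bs CSU \<Sigma> s t)"
proof -
  interpret raised_problem \<Sigma> s t cs prime
    using assms(1-8,10) by unfold_locales auto
  have len: "length \<tau>s = length cs" using assms(6) by auto
  let ?u = "\<lambda>as. lam_noms (bs as) (tm_subst s \<sigma>)"
  let ?v = "\<lambda>as. lam_noms (bs as) (lam_noms as (tm_subst t \<sigma>))"
  have sols: "solution_set prime cs bs CSU \<Sigma> s t =
      {nom_comp \<sigma> \<rho> | \<rho>. \<exists>as \<in> selections t cs. \<rho> \<in> CSU (?u as) (?v as)}"
    unfolding solution_set_def Let_def by auto
  show ?thesis
    unfolding complete_na_solutions_def len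
  proof (intro conjI ballI allI impI)
    fix \<theta> assume "\<theta> \<in> solution_set prime cs bs CSU \<Sigma> s t"
    then obtain as \<rho> where as: "as \<in> selections t cs" and \<rho>: "\<rho> \<in> CSU (?u as) (?v as)"
      and \<theta>: "\<theta> = nom_comp \<sigma> \<rho>" unfolding sols by blast
    have "unifier (?u as) (?v as) \<rho>" using assms(12) \<rho> by (simp add: complete_unifiers_def)
    moreover have "distinct as" "length as = length cs"
      using as by (auto simp: selections_def dest: map_eq_imp_length_eq)
    ultimately show "na_solution (NAbs (length cs) s t) \<theta>"
      unfolding \<theta> using assms(11)[OF as] by (intro nom_comp_solution[of as "bs as"]) auto
  next
    fix \<rho> assume sol: "na_solution (NAbs (length cs) s t) \<rho>"
    then have \<rho>: "is_subst \<rho>" by (simp add: na_solution_def)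
    obtain \<mu> as where \<mu>: "is_perm \<mu>" and as: "as \<in> selections t cs"
      and eq: "tm_subst s (perm_subst \<mu> \<rho>) = lam_noms as (tm_subst t (perm_subst \<mu> \<rho>))"
      and disj: "supp_subst (perm_subst \<mu> \<rho>) \<inter> (supp s \<union> supp t) = {}"
      by (rule normalize_solution[OF sol])
    have "set as \<subseteq> supp t \<union> set cs" using as by (simp add: selections_def)
    then have "unifier (?u as) (?v as) (lower (perm_subst \<mu> \<rho>))"
      using assms(11)[OF as] by (intro unifier_lower is_subst_perm \<mu> \<rho> eq disj) auto
    from complete_unifiers_less_general[OF \<rho> \<mu> this assms(12)]
    show "\<exists>\<theta> \<in> solution_set prime cs bs CSU \<Sigma> s t. less_general_on \<Sigma> \<rho> \<theta>"
      unfolding sols using as by blast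
  qed
qed

end
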